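(* Let $L \subseteq \mathbb{R}^n$ be an $n$-dimensional lattice. Then $$c_2(\mathbb{R}^n/L)^2 = \min\Big\{ C : C \in \mathbb{R}_+,\ z \in \ell^1(L^* ),\ z(u) = z(-u) \ge 0 \text{ for all } u \in L^*,\ |x|^2 \le 2\sum_{u \in L^*} z(u)\,(1-\cos(2\pi u^{\mathsf T} x)) \text{ for all } x \in V(L),\ C I - 4\pi^2 \sum_{u \in L^*} z(u)\,uu^{\mathsf T} \in \mathcal{S}^n_+\Big\}.$$
   Context: An $n$-dimensional lattice $L\subseteq\mathbb{R}^n$ is the set of all integral linear combinations of a basis of $\mathbb{R}^n$; $|x|=\sqrt{x^{\mathsf T}x}$. The flat torus $\mathbb{R}^n/L$ has the metric $d_{\mathbb{R}^n/L}(x,y)=\min_{v\in L}|x-y-v|$. The dual lattice is $L^*=\{u\in\mathbb{R}^n: u^{\mathsf T}v\in\mathbb{Z}\text{ for all }v\in L\}$. The Voronoi cell is $V(L)=\{x\in\mathbb{R}^n: |x|\le|x-v|\text{ for all }v\in L\}$. A Euclidean embedding of $\mathbb{R}^n/L$ is an injective function $\varphi:\mathbb{R}^n/L\to H$ into some (complex) Hilbert space $H$. Its distortion is $$\mathrm{dist}(\varphi)=\sup_{x\ne y}\frac{\|\varphi(x)-\varphi(y)\|}{d_{\mathbb{R}^n/L}(x,y)}\cdot\sup_{x\neq y}\frac{d_{\mathbb{R}^n/L}(x,y)}{\|\varphi(x)-\varphi(y)\|},$$ with suprema over distinct $x,y\in\mathbb{R}^n/L$. The least (Euclidean) distortion is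 $c_2(\mathbb{R}^n/L)=\inf\{\mathrm{dist}(\varphi)\}$ over all Euclidean embeddings $\varphi$ of $\mathbb{R}^n/L$ into Hilbert spaces. $\ell^1(L^* )=\{z:L^*\to\mathbb{C}:\sum_{u\in L^*}|z(u)|<\infty\}$; $\mathbb{R}_+$ denotes the nonnegative reals; $I$ is the $n\times n$ identity matrix; $\mathcal{S}^n_+$ is the cone of real symmetric positive semidefinite $n\times n$ matrices. The semidefinite constraint includes the requirement that the matrix series converges. Writing $\min$ includes the assertion that the minimum is attained. *)

theory Defs
  imports "HOL-Analysis.Analysis" "HOL-Library.Complex_Order" "HOL-Algebra.Module"
begin

section \<open>Lattices and flat tori\<close>

definition is_lattice :: "(real^'n) set \<Rightarrow> bool" where
  "is_lattice L \<longleftrightarrow>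
     (\<exists>B. independent B \<and> span B = UNIV \<and>
          L = range (\<lambda>k :: real^'n \<Rightarrow> int. \<Sum>b\<in>B. of_int (k b) *\<^sub>R b))"

definition dual_lattice :: "(real^'n) set \<Rightarrow> (real^'n) set" where
  "dual_lattice L = {u. \<forall>v\<in>L. u \<bullet> v \<in> \<int>}"

definition voronoi_cell :: "(real^'n) set \<Rightarrow> (real^'n) set" where
  "voronoi_cell L = {x. \<forall>v\<in>L. norm x \<le> norm (x - v)}"

definition torus :: "(real^'n) set \<Rightarrow> (real^'n) set set" where
  "torus L = UNIV // {(x, y). x - y \<in> L}"

text \<open>
  Points of the torus are cosets. For a lattice the set below does not change if
  \<open>x\<close> and \<open>y\<close> are fixed representatives, since \<open>v\<close> ranges over \<open>L\<close>.
\<close>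

definition torus_dist :: "(real^'n) set \<Rightarrow> (real^'n) set \<Rightarrow> (real^'n) set \<Rightarrow> real" where
  "torus_dist L X Y = Inf {norm (x - y - v) | x y v. x \<in> X \<and> y \<in> Y \<and> v \<in> L}"


section \<open>Complex Hilbert spaces\<close>

definition complex_field :: "complex ring" where
  "complex_field = \<lparr>carrier = UNIV, monoid.mult = (*), one = 1, zero = 0, add = (+)\<rparr>"

text \<open>
  Hilbert spaces are structures on a carrier set, so that one can quantify over all of
  them. The inner product is linear in its second argument. The ring fields \<open>mult\<close> and
  \<open>one\<close>, which modules inherit in HOL-Algebra, play no role.
\<close>

record 'h inner_space = "(complex, 'h) module" +
  cinner :: "'h \<Rightarrow> 'h \<Rightarrow> complex"

definition hnorm :: "('h, 'm) inner_space_scheme \<Rightarrow> 'h \<Rightarrow> real" where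
  "hnorm H x = sqrt (Re (cinner H x x))"

definition hdist :: "('h, 'm) inner_space_scheme \<Rightarrow> 'h \<Rightarrow> 'h \<Rightarrow> real" where
  "hdist H x y = hnorm H (x \<ominus>\<^bsub>H\<^esub> y)"

locale complex_inner_space = Module.module complex_field H for H (structure) +
  assumes cinner_add_right:
      "\<lbrakk>x \<in> carrier H; y \<in> carrier H; w \<in> carrier H\<rbrakk> \<Longrightarrow>
        cinner H x (y \<oplus> w) = cinner H x y + cinner H x w"
    and cinner_smult_right:
      "\<lbrakk>x \<in> carrier H; y \<in> carrier H\<rbrakk> \<Longrightarrow> cinner H x (a \<odot> y) = a * cinner H x y"
    and cinner_cnj:
      "\<lbrakk>x \<in> carrier H; y \<in> carrier H\<rbrakk> \<Longrightarrow> cinner H y x = cnj (cinner H x y)"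
    and cinner_pos:
      "\<lbrakk>x \<in> carrier H; x \<noteq> \<zero>\<rbrakk> \<Longrightarrow> 0 < cinner H x x"

locale complex_hilbert_space = complex_inner_space +
  assumes complete:
      "\<lbrakk>range \<sigma> \<subseteq> carrier H; \<forall>\<epsilon>>0. \<exists>N. \<forall>m\<ge>N. \<forall>n\<ge>N. hdist H (\<sigma> m) (\<sigma> n) < \<epsilon>\<rbrakk> \<Longrightarrow>
        \<exists>x\<in>carrier H. (\<lambda>n. hdist H (\<sigma> n) x) \<longlonglongrightarrow> 0"


section \<open>Euclidean distortion\<close>

definition euclidean_embedding ::
    "(real^'n) set \<Rightarrow> ('h, 'm) inner_space_scheme \<Rightarrow> ((real^'n) set \<Rightarrow> 'h) \<Rightarrow> bool" where
  "euclidean_embedding L H \<phi> \<longleftrightarrow>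
     complex_hilbert_space H \<and> \<phi> \<in> torus L \<rightarrow> carrier H \<and> inj_on \<phi> (torus L)"

text \<open>
  Either supremum may be infinite, so distortions are extended nonnegative reals. For a
  lattice the denominators are positive, because distinct points of the torus have positive
  distance and \<open>\<phi>\<close> is injective; both suprema are then positive, and the product is not
  of the form \<open>0 * \<infinity>\<close>.
\<close>

definition distortion ::
    "(real^'n) set \<Rightarrow> ('h, 'm) inner_space_scheme \<Rightarrow> ((real^'n) set \<Rightarrow> 'h) \<Rightarrow> ennreal" where
  "distortion L H \<phi> =
     (SUP (X, Y) \<in> {(X, Y). X \<in> torus L \<and> Y \<in> torus L \<and> X \<noteq> Y}.
        ennreal (hdist H (\<phi> X) (\<phi> Y) / torus_dist L X Y)) *
     (SUP (X, Y) \<in> {(X, Y). X \<in> torus L \<and> Y \<in> torus L \<and> X \<noteq> Y}.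
        ennreal (torus_dist L X Y / hdist H (\<phi> X) (\<phi> Y)))"

text \<open>
  HOL cannot quantify over types inside a definition, so the infimum ranges over the Hilbert
  spaces whose elements have the fixed type \<open>(real^'n) set \<Rightarrow> complex\<close>. This loses no
  Hilbert space: lemma \<open>c2_le_distortion\<close> shows that the infimum is a lower bound for the
  distortion of the embeddings into Hilbert spaces on an arbitrary type.
\<close>

definition c2 :: "(real^'n) set \<Rightarrow> ennreal" where
  "c2 L = Inf {distortion L H \<phi> | (H :: ((real^'n) set \<Rightarrow> complex) inner_space) \<phi>.
                 euclidean_embedding L H \<phi>}"


section \<open>The semidefinite program\<close>

definition ell1 :: "'a set \<Rightarrow> ('a \<Rightarrow> complex) set" where
  "ell1 A = {z. (\<lambda>u. cmod (z u)) summable_on A}"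

definition outer_square :: "real^'n \<Rightarrow> real^'n^'n" where
  "outer_square u = (\<chi> i j. u $ i * u $ j)"

definition psd :: "real^'n^'n \<Rightarrow> bool" where
  "psd A \<longleftrightarrow> transpose A = A \<and> (\<forall>x. 0 \<le> x \<bullet> (A *v x))"

text \<open>
  The constraint \<open>0 \<le> z u\<close> refers to the order on complex numbers in which comparable
  numbers have equal imaginary parts; it says that \<open>z u\<close> is a nonnegative real.
\<close>

definition feasible :: "(real^'n) set \<Rightarrow> real \<Rightarrow> (real^'n \<Rightarrow> complex) \<Rightarrow> bool" where
  "feasible L C z \<longleftrightarrow>
     0 \<le> C \<and>
     z \<in> ell1 (dual_lattice L) \<and>
     (\<forall>u\<in>dual_lattice L. z u = z (- u) \<and> 0 \<le> z u) \<and>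
     (\<forall>x\<in>voronoi_cell L.
        (norm x)\<^sup>2 \<le> 2 * (\<Sum>\<^sub>\<infinity>u\<in>dual_lattice L. Re (z u) * (1 - cos (2 * pi * (u \<bullet> x))))) \<and>
     (\<lambda>u. Re (z u) *\<^sub>R outer_square u) summable_on dual_lattice L \<and>
     psd (C *\<^sub>R mat 1 -
          (4 * pi\<^sup>2) *\<^sub>R (\<Sum>\<^sub>\<infinity>u\<in>dual_lattice L. Re (z u) *\<^sub>R outer_square u))"


section \<open>Independence of the type of the Hilbert space\<close>

lemma complex_field_simps [simp]:
  "carrier complex_field = UNIV" "a \<otimes>\<^bsub>complex_field\<^esub> b = a * b" "\<one>\<^bsub>complex_field\<^esub> = 1"
  "\<zero>\<^bsub>complex_field\<^esub> = 0" "a \<oplus>\<^bsub>complex_field\<^esub> b = a + b"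
  by (simp_all add: complex_field_def)

lemma cring_complex_field: "cring complex_field"
proof (rule cringI)
  show "abelian_group complex_field"
    by (rule abelian_groupI) (auto simp: algebra_simps intro: exI[of _ "- _"])
  show "comm_monoid complex_field"
    by (rule comm_monoidI) (auto simp: algebra_simps)
qed (auto simp: algebra_simps)

lemma complex_field_uminus [simp]: "\<ominus>\<^bsub>complex_field\<^esub> a = - a"
proof -
  interpret cring complex_field by (rule cring_complex_field)
  have "a \<oplus>\<^bsub>complex_field\<^esub> (\<ominus>\<^bsub>complex_field\<^esub> a) = \<zero>\<^bsub>complex_field\<^esub>"
    by (rule r_neg) simp
  then show ?thesis by (simp add: add_eq_0_iff)
qed

context complex_inner_space
begin

lemma smult_closed' [simp, intro]: "x \<in> carrier H \<Longrightarrow> a \<odot> x \<in> carrier H"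
  by (rule smult_closed) auto

lemma minus_eq_smult: "\<lbrakk>x \<in> carrier H; y \<in> carrier H\<rbrakk> \<Longrightarrow> x \<ominus> y = x \<oplus> (-1) \<odot> y"
  using smult_l_minus[of 1 y] smult_one[of y] by (simp add: a_minus_def)

lemma cinner_add_left:
  "\<lbrakk>x \<in> carrier H; y \<in> carrier H; w \<in> carrier H\<rbrakk> \<Longrightarrow>
    cinner H (y \<oplus> w) x = cinner H y x + cinner H w x"
  using cinner_cnj[of x "y \<oplus> w"] cinner_cnj[of x y] cinner_cnj[of x w] cinner_add_right[of x y w]
  by simp

lemma cinner_smult_left:
  "\<lbrakk>x \<in> carrier H; y \<in> carrier H\<rbrakk> \<Longrightarrow> cinner H (a \<odot> y) x = cnj a * cinner H y x"
  using cinner_cnj[of x "a \<odot> y"] cinner_cnj[of x y] cinner_smult_right[of x y a] by simp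

lemma cinner_zero [simp]:
  assumes "x \<in> carrier H" shows "cinner H x \<zero> = 0" "cinner H \<zero> x = 0"
  using cinner_smult_right[of x \<zero> 0] cinner_smult_left[of x \<zero> 0] assms smult_l_null[of \<zero>]
  by simp_all

lemma cinner_self_ge: "x \<in> carrier H \<Longrightarrow> 0 \<le> cinner H x x"
  using cinner_pos[of x] by (cases "x = \<zero>") (auto intro: less_imp_le)

lemma hnorm_square: "x \<in> carrier H \<Longrightarrow> cinner H x x = complex_of_real ((hnorm H x)\<^sup>2)"
  using cinner_self_ge[of x] by (auto simp: hnorm_def less_eq_complex_def complex_eq_iff)

lemma hnorm_ge [simp]: "x \<in> carrier H \<Longrightarrow> 0 \<le> hnorm H x"
  using cinner_self_ge[of x] by (auto simp: hnorm_def less_eq_complex_def)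

lemma hnorm_eq_0_iff: "x \<in> carrier H \<Longrightarrow> hnorm H x = 0 \<longleftrightarrow> x = \<zero>"
  using cinner_pos[of x] by (cases "x = \<zero>") (auto simp: hnorm_def less_complex_def)

lemma Cauchy_Schwarz:
  assumes x: "x \<in> carrier H" and y: "y \<in> carrier H"
  shows "cmod (cinner H x y) \<le> hnorm H x * hnorm H y"
proof (cases "x = \<zero>")
  case True
  then show ?thesis using y by (simp add: hnorm_def)
next
  case False
  define N where "N = (hnorm H x)\<^sup>2"
  define p where "p = cinner H x y"
  have N: "N > 0" using False x by (simp add: N_def hnorm_eq_0_iff)
  define a where "a = - p / complex_of_real N"
  have yx: "cinner H y x = cnj p" using cinner_cnj[OF x y] by (simp add: p_def)
  have xx: "cinner H x x = complex_of_real N" using hnorm_square[OF x] by (simp add: N_def)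
  have "cinner H (y \<oplus> a \<odot> x) (y \<oplus> a \<odot> x) =
      cinner H y y + a * cnj p + cnj a * p + cnj a * a * complex_of_real N"
    using x y by (simp add: cinner_add_left cinner_add_right cinner_smult_left cinner_smult_right
        yx xx p_def[symmetric] distrib_left mult.assoc)
  also have "\<dots> = cinner H y y - complex_of_real ((cmod p)\<^sup>2 / N)"
  proof -
    have "a * cnj p = - complex_of_real ((cmod p)\<^sup>2 / N)"
      unfolding of_real_divide complex_norm_square by (simp add: a_def)
    moreover have "cnj a * p = - complex_of_real ((cmod p)\<^sup>2 / N)"
      unfolding of_real_divide complex_norm_square by (simp add: a_def mult.commute)
    moreover have "a * complex_of_real N = - p" using N by (simp add: a_def)
    ultimately show ?thesis by (simp add: mult.assoc)
  qed
  finally have "0 \<le> Re (cinner H y y - complex_of_real ((cmod p)\<^sup>2 / N))"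
    using cinner_self_ge[of "y \<oplus> a \<odot> x"] x y by (simp add: less_eq_complex_def)
  then have "(cmod p)\<^sup>2 / N \<le> (hnorm H y)\<^sup>2" using y by (simp add: hnorm_square)
  then have "(cmod p)\<^sup>2 \<le> (hnorm H x * hnorm H y)\<^sup>2"
    using N by (simp add: divide_le_eq N_def power_mult_distrib mult.commute)
  then have "cmod p \<le> hnorm H x * hnorm H y"
    by (rule power2_le_imp_le) (simp add: x y)
  then show ?thesis by (simp add: p_def)
qed

lemma cinner_eq_0_limit:
  assumes \<sigma>: "\<And>n. \<sigma> n \<in> carrier H" and x: "x \<in> carrier H" and h: "h \<in> carrier H"
    and lim: "(\<lambda>n. hdist H (\<sigma> n) x) \<longlonglongrightarrow> 0" and 0: "\<And>n. cinner H h (\<sigma> n) = 0"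
  shows "cinner H h x = 0"
proof -
  have "cmod (cinner H h x) \<le> hnorm H h * hdist H (\<sigma> n) x" for n
  proof -
    have "cinner H h (\<sigma> n \<ominus> x) = - cinner H h x"
      using \<sigma>[of n] x h 0[of n] by (simp add: minus_eq_smult cinner_add_right cinner_smult_right)
    then show ?thesis
      using Cauchy_Schwarz[OF h, of "\<sigma> n \<ominus> x"] \<sigma>[of n] x by (simp add: hdist_def)
  qed
  moreover have "(\<lambda>n. hnorm H h * hdist H (\<sigma> n) x) \<longlonglongrightarrow> 0"
    using tendsto_mult_left[OF lim, of "hnorm H h"] by simp
  ultimately have "cmod (cinner H h x) \<le> 0"
    by (intro LIMSEQ_le_const) auto
  then show ?thesis by simp
qed

end

inductive_set closed_span :: "('h, 'm) inner_space_scheme \<Rightarrow> 'h set \<Rightarrow> 'h set"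
  for H :: "('h, 'm) inner_space_scheme" and A :: "'h set" where
  base: "x \<in> A \<Longrightarrow> x \<in> closed_span H A"
| zero: "\<zero>\<^bsub>H\<^esub> \<in> closed_span H A"
| add: "\<lbrakk>x \<in> closed_span H A; y \<in> closed_span H A\<rbrakk> \<Longrightarrow> x \<oplus>\<^bsub>H\<^esub> y \<in> closed_span H A"
| smult: "x \<in> closed_span H A \<Longrightarrow> a \<odot>\<^bsub>H\<^esub> x \<in> closed_span H A"
| limit: "\<lbrakk>\<And>n. \<sigma> n \<in> closed_span H A; x \<in> carrier H; (\<lambda>n. hdist H (\<sigma> n) x) \<longlonglongrightarrow> 0\<rbrakk> \<Longrightarrow>
           x \<in> closed_span H A"

context complex_inner_space
begin

lemma closed_span_subset:
  assumes A: "A \<subseteq> carrier H" and x: "x \<in> closed_span H A"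
  shows "x \<in> carrier H"
  using x by (induction rule: closed_span.induct) (use A in auto)

lemma closed_span_orthogonal:
  assumes A: "A \<subseteq> carrier H" and h: "h \<in> carrier H" and 0: "\<And>x. x \<in> A \<Longrightarrow> cinner H h x = 0"
    and x: "x \<in> closed_span H A"
  shows "cinner H h x = 0"
  using x
proof (induction rule: closed_span.induct)
  case (base x)
  then show ?case by (rule 0)
next
  case zero
  show ?case using h by simp
next
  case (add x y)
  then show ?case
    using closed_span_subset[OF A, of x] closed_span_subset[OF A, of y] h
    by (simp add: cinner_add_right)
next
  case (smult x a)
  then show ?case
    using closed_span_subset[OF A, of x] h by (simp add: cinner_smult_right)
next
  case (limit \<sigma> x)
  show ?case
    by (rule cinner_eq_0_limit[OF closed_span_subset[OF A limit.hyps(1)] limit.hyps(2) h])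
      (fact limit)+
qed

text \<open>Elements of the closed span of \<open>A\<close> are determined by their inner products with \<open>A\<close>.\<close>

lemma closed_span_eqI:
  assumes A: "A \<subseteq> carrier H" and x: "x \<in> closed_span H A" and y: "y \<in> closed_span H A"
    and eq: "\<And>a. a \<in> A \<Longrightarrow> cinner H a x = cinner H a y"
  shows "x = y"
proof -
  note S = closed_span_subset[OF A]
  let ?d = "x \<oplus> (-1) \<odot> y"
  have d: "?d \<in> closed_span H A" using x y by (intro closed_span.add closed_span.smult)
  have "cinner H ?d a = 0" if a: "a \<in> A" for a
  proof -
    have aH: "a \<in> carrier H" using a A by blast
    have "cinner H a ?d = 0"
      using aH eq[OF a] S[OF x] S[OF y] by (simp add: cinner_add_right cinner_smult_right)
    then show ?thesis using cinner_cnj[OF aH S[OF d]] by (simp only: complex_cnj_zero)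
  qed
  then have "cinner H ?d ?d = 0" using closed_span_orthogonal[OF A S[OF d] _ d] by blast
  then have "?d = \<zero>" using cinner_pos[OF S[OF d]] by auto
  then have "x \<oplus> \<ominus> y = \<zero>"
    using minus_eq_smult[OF S[OF x] S[OF y]] by (simp add: a_minus_def)
  then have "\<ominus> (\<ominus> y) = x"
    using S[OF x] S[OF y] by (intro M.minus_equality) auto
  then show ?thesis using S[OF y] by simp
qed

end

definition transport ::
    "('h, 'm) inner_space_scheme \<Rightarrow> 'h set \<Rightarrow> ('h \<Rightarrow> 'g) \<Rightarrow> 'g inner_space" where
  "transport H S F =
     \<lparr>carrier = F ` S, monoid.mult = undefined, one = undefined, zero = F \<zero>\<^bsub>H\<^esub>,
      add = (\<lambda>f g. F (inv_into S F f \<oplus>\<^bsub>H\<^esub> inv_into S F g)),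
      smult = (\<lambda>a f. F (a \<odot>\<^bsub>H\<^esub> inv_into S F f)),
      cinner = (\<lambda>f g. cinner H (inv_into S F f) (inv_into S F g))\<rparr>"

lemma
  fixes H :: "('h, 'm) inner_space_scheme" and F :: "'h \<Rightarrow> 'g"
  assumes H: "complex_hilbert_space H" and A: "A \<subseteq> carrier H"
    and inj: "inj_on F (closed_span H A)"
  defines "S \<equiv> closed_span H A"
  defines "T \<equiv> transport H S F"
  shows transport_hilbert: "complex_hilbert_space T"
    and transport_hdist: "\<And>x y. \<lbrakk>x \<in> S; y \<in> S\<rbrakk> \<Longrightarrow> hdist T (F x) (F y) = hdist H x y"
proof -
  interpret H: complex_hilbert_space H by (rule H)
  have inv [simp]: "inv_into S F (F x) = x" if "x \<in> S" for x
    using inj that by (simp add: S_def)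
  have SH: "x \<in> carrier H" if "x \<in> S" for x
    using that H.closed_span_subset[OF A] by (simp add: S_def)
  have S [simp]: "\<zero>\<^bsub>H\<^esub> \<in> S" "\<And>x y. \<lbrakk>x \<in> S; y \<in> S\<rbrakk> \<Longrightarrow> x \<oplus>\<^bsub>H\<^esub> y \<in> S"
      "\<And>a x. x \<in> S \<Longrightarrow> a \<odot>\<^bsub>H\<^esub> x \<in> S"
    unfolding S_def by (auto intro: closed_span.zero closed_span.add closed_span.smult)
  have T [simp]: "carrier T = F ` S" "\<zero>\<^bsub>T\<^esub> = F \<zero>\<^bsub>H\<^esub>"
      "\<And>x y. \<lbrakk>x \<in> S; y \<in> S\<rbrakk> \<Longrightarrow> F x \<oplus>\<^bsub>T\<^esub> F y = F (x \<oplus>\<^bsub>H\<^esub> y)"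
      "\<And>a x. x \<in> S \<Longrightarrow> a \<odot>\<^bsub>T\<^esub> F x = F (a \<odot>\<^bsub>H\<^esub> x)"
      "\<And>x y. \<lbrakk>x \<in> S; y \<in> S\<rbrakk> \<Longrightarrow> cinner T (F x) (F y) = cinner H x y"
    by (simp_all add: T_def transport_def)
  have ab: "abelian_group T"
  proof (rule abelian_groupI)
    fix f assume "f \<in> carrier T"
    then obtain x where x: "x \<in> S" "f = F x" by auto
    have "(-1) \<odot>\<^bsub>H\<^esub> x = \<ominus>\<^bsub>H\<^esub> x"
      using x SH H.smult_l_minus[of 1 x] H.smult_one[of x] by simp
    then have "F ((-1) \<odot>\<^bsub>H\<^esub> x) \<oplus>\<^bsub>T\<^esub> f = \<zero>\<^bsub>T\<^esub>"
      using x SH S(3)[of x "-1"] by (simp add: H.M.l_neg)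
    then show "\<exists>g\<in>carrier T. g \<oplus>\<^bsub>T\<^esub> f = \<zero>\<^bsub>T\<^esub>"
      using x by auto
  qed (auto simp: SH H.M.a_ac)
  have mod: "Module.module complex_field T"
  proof (rule moduleI)
    fix a b :: complex and f assume "f \<in> carrier T"
    then show "(a \<oplus>\<^bsub>complex_field\<^esub> b) \<odot>\<^bsub>T\<^esub> f = a \<odot>\<^bsub>T\<^esub> f \<oplus>\<^bsub>T\<^esub> b \<odot>\<^bsub>T\<^esub> f"
      using H.smult_l_distr[of a b] by (auto simp: SH)
  next
    fix a b :: complex and f assume "f \<in> carrier T"
    then show "(a \<otimes>\<^bsub>complex_field\<^esub> b) \<odot>\<^bsub>T\<^esub> f = a \<odot>\<^bsub>T\<^esub> (b \<odot>\<^bsub>T\<^esub> f)"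
      using H.smult_assoc1[of a b] by (auto simp: SH)
  next
    fix f assume "f \<in> carrier T"
    then show "\<one>\<^bsub>complex_field\<^esub> \<odot>\<^bsub>T\<^esub> f = f"
      using H.smult_one by (auto simp: SH)
  qed (use ab cring_complex_field in \<open>auto simp: SH H.smult_r_distr\<close>)
  have T_inner: "complex_inner_space T"
  proof (intro complex_inner_space.intro mod complex_inner_space_axioms.intro)
    fix f assume "f \<in> carrier T" "f \<noteq> \<zero>\<^bsub>T\<^esub>"
    then obtain x where "x \<in> S" "f = F x" "x \<noteq> \<zero>\<^bsub>H\<^esub>" by auto
    then show "0 < cinner T f f" using H.cinner_pos[of x] by (simp add: SH)
  next
    fix f g assume "f \<in> carrier T" "g \<in> carrier T"
    then obtain x y where "x \<in> S" "f = F x" "y \<in> S" "g = F y" by auto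
    then show "cinner T g f = cnj (cinner T f g)" using H.cinner_cnj[of x y] by (simp add: SH)
  qed (auto simp: SH H.cinner_add_right H.cinner_smult_right)
  then interpret T: complex_inner_space T .
  show dist: "hdist T (F x) (F y) = hdist H x y" if "x \<in> S" "y \<in> S" for x y
    using that by (simp add: hdist_def hnorm_def T.minus_eq_smult H.minus_eq_smult SH)
  show "complex_hilbert_space T"
  proof (intro complex_hilbert_space.intro T_inner complex_hilbert_space_axioms.intro)
    fix \<sigma> :: "nat \<Rightarrow> 'g" assume \<sigma>: "range \<sigma> \<subseteq> carrier T"
      and Cauchy: "\<forall>\<epsilon>>0. \<exists>N. \<forall>m\<ge>N. \<forall>n\<ge>N. hdist T (\<sigma> m) (\<sigma> n) < \<epsilon>"
    define \<tau> where "\<tau> n = inv_into S F (\<sigma> n)" for n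
    have \<tau>: "\<tau> n \<in> S" "\<sigma> n = F (\<tau> n)" for n
      using \<sigma> by (auto simp: \<tau>_def image_subset_iff intro: inv_into_into f_inv_into_f[symmetric])
    have "\<exists>x\<in>carrier H. (\<lambda>n. hdist H (\<tau> n) x) \<longlonglongrightarrow> 0"
      using Cauchy \<tau> by (intro H.complete) (auto simp: dist SH)
    then obtain x where x: "x \<in> carrier H" "(\<lambda>n. hdist H (\<tau> n) x) \<longlonglongrightarrow> 0" by blast
    have "x \<in> S"
      unfolding S_def by (rule closed_span.limit[OF _ x]) (use \<tau>(1) in \<open>simp add: S_def\<close>)
    then show "\<exists>f\<in>carrier T. (\<lambda>n. hdist T (\<sigma> n) f) \<longlonglongrightarrow> 0"
      using x \<tau> by (auto simp: dist)
  qed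
qed

theorem c2_le_distortion:
  fixes H :: "('h, 'm) inner_space_scheme" and L :: "(real^'n) set"
  assumes \<phi>: "euclidean_embedding L H \<phi>"
  shows "c2 L \<le> distortion L H \<phi>"
proof -
  let ?A = "\<phi> ` torus L"
  let ?S = "closed_span H ?A"
  interpret H: complex_hilbert_space H using \<phi> by (simp add: euclidean_embedding_def)
  have A: "?A \<subseteq> carrier H" using \<phi> by (auto simp: euclidean_embedding_def)
  define F where "F x = (\<lambda>X. cinner H (\<phi> X) x)" for x
  have inj: "inj_on F ?S"
  proof (rule inj_onI)
    fix x y assume "x \<in> ?S" "y \<in> ?S" and eq: "F x = F y"
    then show "x = y"
      using fun_cong[OF eq[unfolded F_def]] H.closed_span_eqI[OF A, of x y] by blast
  qed
  define T where "T = transport H ?S F"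
  have T: "complex_hilbert_space T"
    unfolding T_def by (rule transport_hilbert[OF H.complex_hilbert_space_axioms A inj])
  have S: "\<phi> X \<in> ?S" if "X \<in> torus L" for X using that by (auto intro: closed_span.base)
  have dist: "hdist T (F (\<phi> X)) (F (\<phi> Y)) = hdist H (\<phi> X) (\<phi> Y)"
    if "X \<in> torus L" "Y \<in> torus L" for X Y
    unfolding T_def
    by (rule transport_hdist[OF H.complex_hilbert_space_axioms A inj S[OF that(1)] S[OF that(2)]])
  have "inj_on (F \<circ> \<phi>) (torus L)"
    using \<phi> by (intro comp_inj_on inj_on_subset[OF inj]) (auto simp: euclidean_embedding_def S)
  then have "euclidean_embedding L T (F \<circ> \<phi>)"
    using T S by (auto simp: euclidean_embedding_def T_def transport_def)
  then have "c2 L \<le> distortion L T (F \<circ> \<phi>)"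
    unfolding c2_def by (intro Inf_lower) blast
  also have "distortion L T (F \<circ> \<phi>) = distortion L H \<phi>"
    unfolding distortion_def
    by (intro arg_cong2[where f = "(*)"] SUP_cong refl) (auto simp: dist)
  finally show ?thesis .
qed

end

theory Submission
  imports Defs "HOL-Real_Asymp.Real_Asymp"
begin

text \<open>
  A feasible pair \<open>(C, z)\<close> describes an embedding with translation-invariant distances. Its weights
  define the map \<open>x \<mapsto> (sqrt (z u) * exp (2 * \<pi> * \<i> * (u \<bullet> x)))\<^sub>u\<close> of the torus into the square
  summable functions on the dual lattice, and the squared distance between the images of \<open>x\<close>
  and \<open>y\<close> is \<open>2 * (\<Sum>u. z u * (1 - cos (2 * \<pi> * (u \<bullet> (x - y)))))\<close>. The constraint on the
  Voronoi cell says that this map does not shrink distances; since \<open>2 * (1 - cos t) \<le> t\<^sup>2\<close>, the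
  semidefinite constraint says that it expands them by at most the factor \<open>sqrt C\<close>. Hence
  \<open>c2 L\<close> squared is at most \<open>C\<close> (lemma \<open>feasible_imp_c2_le\<close>).

  Conversely, averaging the squared distances of an arbitrary embedding over the translations
  of the torus produces an invariant one that is no worse. The averaging is done here over the
  finite group \<open>(1/N) L / L\<close>, with \<open>N = 2 * r + 1\<close>, where harmonic analysis consists of finite
  sums (lemma \<open>finite_fourier\<close>): every embedding of distortion \<open>D\<close> yields nonnegative weights
  on a finite box of dual lattice vectors, whose energy lies between the squared torus distance
  and \<open>D\<^sup>2\<close> times the squared norm at all points of \<open>(1/N) L\<close> (lemma \<open>embedding_weights\<close>).

  Now let \<open>N\<close> tend to infinity along embeddings whose distortions tend to \<open>c2 L\<close>. The upper
  bound at the points \<open>e i / N\<close> controls the second moments of the weights uniformly in \<open>N\<close>.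
  So the weights stay in a compact product of intervals, no mass escapes to infinity, and a
  cluster point is feasible for \<open>C = (c2 L)\<^sup>2\<close> (lemma \<open>weights_limit\<close>). This shows at once that
  \<open>(c2 L)\<^sup>2\<close> is an upper bound for the minimum and that the minimum is attained.
\<close>


section \<open>Lattices in coordinates\<close>

text \<open>
  The indexing set is kept abstract and the two families are treated alike, so that exchanging
  \<open>e\<close> and \<open>d\<close> exchanges the lattice with its dual. Every fact below is then available for both.
\<close>

locale dual_bases =
  fixes I :: "'i set" and e d :: "'i \<Rightarrow> 'a::euclidean_space"
  assumes finite_index: "finite I"
    and biorthogonal: "\<lbrakk>i \<in> I; j \<in> I\<rbrakk> \<Longrightarrow> d i \<bullet> e j = (if i = j then 1 else 0)"
    and expand: "x = (\<Sum>i\<in>I. (d i \<bullet> x) *\<^sub>R e i)"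
begin

definition lat :: "'a set" where
  "lat = {v. \<forall>i\<in>I. d i \<bullet> v \<in> \<int>}"

definition cube :: "nat \<Rightarrow> 'a set" where
  "cube r = {v \<in> lat. \<forall>i\<in>I. \<bar>d i \<bullet> v\<bar> \<le> r}"

lemma inner_expand: "u \<bullet> x = (\<Sum>i\<in>I. (u \<bullet> e i) * (d i \<bullet> x))"
proof -
  have "u \<bullet> x = u \<bullet> (\<Sum>i\<in>I. (d i \<bullet> x) *\<^sub>R e i)" by (rule arg_cong[OF expand])
  then show ?thesis by (simp add: inner_sum_right mult.commute)
qed

lemma swap: "dual_bases I d e"
proof
  show "e i \<bullet> d j = (if i = j then 1 else 0)" if "i \<in> I" "j \<in> I" for i j
    using biorthogonal[OF that(2,1)] by (auto simp: inner_commute)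
  show "x = (\<Sum>i\<in>I. (e i \<bullet> x) *\<^sub>R d i)" for x
  proof -
    have "x \<bullet> y = (\<Sum>i\<in>I. (e i \<bullet> x) *\<^sub>R d i) \<bullet> y" for y
      unfolding inner_expand[of x y] by (simp add: inner_sum_left inner_sum_right inner_commute)
    then show ?thesis by (metis vector_eq_rdot)
  qed
qed (rule finite_index)

lemma coord_comb: "i \<in> I \<Longrightarrow> d i \<bullet> (\<Sum>j\<in>I. c j *\<^sub>R e j) = c i"
  using finite_index by (simp add: inner_sum_right biorthogonal if_distrib cong: if_cong)

lemma coord_eqI: "(\<And>i. i \<in> I \<Longrightarrow> d i \<bullet> x = d i \<bullet> y) \<Longrightarrow> x = y"
  using expand[of x] expand[of y] by (metis (no_types, lifting) sum.cong)

text \<open>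
  Cauchy--Schwarz for the expansion in the basis. It is used in both directions of the duality:
  to compare a vector with its reduction modulo the lattice, and to bound a dual vector by its
  inner products with the basis.
\<close>

lemma norm_le_coords: "(norm x)\<^sup>2 \<le> (\<Sum>i\<in>I. (norm (e i))\<^sup>2) * (\<Sum>i\<in>I. (d i \<bullet> x)\<^sup>2)"
proof -
  have "norm x \<le> (\<Sum>i\<in>I. \<bar>norm (e i)\<bar> * \<bar>d i \<bullet> x\<bar>)"
    by (subst expand[of x]) (rule sum_norm_le, simp add: mult.commute)
  also have "\<dots> \<le> L2_set (\<lambda>i. norm (e i)) I * L2_set (\<lambda>i. d i \<bullet> x) I"
    by (rule L2_set_mult_ineq)
  finally have "(norm x)\<^sup>2 \<le> (L2_set (\<lambda>i. norm (e i)) I * L2_set (\<lambda>i. d i \<bullet> x) I)\<^sup>2"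
    by (rule power_mono) simp
  then show ?thesis by (simp add: power_mult_distrib L2_set_def sum_nonneg)
qed

lemma lat_0: "0 \<in> lat"
  and lat_add: "v \<in> lat \<Longrightarrow> w \<in> lat \<Longrightarrow> v + w \<in> lat"
  and lat_diff: "v \<in> lat \<Longrightarrow> w \<in> lat \<Longrightarrow> v - w \<in> lat"
  and lat_minus: "v \<in> lat \<Longrightarrow> - v \<in> lat"
  by (auto simp: lat_def inner_add_right inner_diff_right)

lemma lat_eq: "lat = range (\<lambda>k :: 'i \<Rightarrow> int. \<Sum>i\<in>I. of_int (k i) *\<^sub>R e i)"
proof (intro equalityI subsetI)
  fix v assume v: "v \<in> lat"
  have "v = (\<Sum>i\<in>I. of_int \<lfloor>d i \<bullet> v\<rfloor> *\<^sub>R e i)"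
    by (subst expand[of v], rule sum.cong) (use v in \<open>auto simp: lat_def elim!: Ints_cases\<close>)
  then show "v \<in> range (\<lambda>k :: 'i \<Rightarrow> int. \<Sum>i\<in>I. of_int (k i) *\<^sub>R e i)"
    by (rule range_eqI[where x = "\<lambda>i. \<lfloor>d i \<bullet> v\<rfloor>"])
qed (auto simp: lat_def coord_comb)

lemma inner_dual_Ints: "\<lbrakk>\<And>i. i \<in> I \<Longrightarrow> u \<bullet> e i \<in> \<int>; v \<in> lat\<rbrakk> \<Longrightarrow> u \<bullet> v \<in> \<int>"
  by (subst inner_expand) (auto simp: lat_def intro!: Ints_sum Ints_mult)

lemma basis_in_lat: "i \<in> I \<Longrightarrow> e i \<in> lat"
  by (simp add: lat_def biorthogonal)

lemma closed_lat: "closed lat"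
proof -
  have "lat = (\<Inter>i\<in>I. (\<bullet>) (d i) -` \<int>)" by (auto simp: lat_def)
  then show ?thesis
    by (auto intro!: closed_INT closed_vimage continuous_intros)
qed

lemma finite_cube: "finite (cube r)"
proof -
  let ?K = "PiE I (\<lambda>_. {- int r..int r})"
  have "cube r \<subseteq> (\<lambda>k. \<Sum>i\<in>I. of_int (k i) *\<^sub>R e i) ` ?K"
  proof
    fix v assume v: "v \<in> cube r"
    let ?k = "restrict (\<lambda>i. \<lfloor>d i \<bullet> v\<rfloor>) I"
    have 1: "\<lfloor>d i \<bullet> v\<rfloor> \<in> {- int r..int r} \<and> of_int \<lfloor>d i \<bullet> v\<rfloor> = d i \<bullet> v" if "i \<in> I" for i
    proof -
      have "d i \<bullet> v \<in> \<int>" using v that by (simp add: cube_def lat_def)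
      then obtain m :: int where "d i \<bullet> v = of_int m" by (rule Ints_cases)
      then show ?thesis using v that by (force simp: cube_def)
    qed
    then have "v = (\<Sum>i\<in>I. of_int (?k i) *\<^sub>R e i)"
      by (subst expand[of v], intro sum.cong refl) (simp add: 1)
    moreover have "?k \<in> ?K" using 1 by auto
    ultimately show "v \<in> (\<lambda>k. \<Sum>i\<in>I. of_int (k i) *\<^sub>R e i) ` ?K" by blast
  qed
  then show ?thesis
    by (rule finite_subset) (intro finite_imageI finite_PiE finite_index finite_atLeastAtMost_int)
qed

lemma cube_0: "0 \<in> cube r"
  by (simp add: cube_def lat_0)

lemma cube_minus: "v \<in> cube r \<Longrightarrow> - v \<in> cube r"
  by (auto simp: cube_def lat_minus)

lemma cube_lat: "v \<in> cube r \<Longrightarrow> v \<in> lat"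
  by (simp add: cube_def)

text \<open>
  The modulus \<open>2 * r + 1\<close> is odd, so the residues can be chosen symmetric around \<open>0\<close>. The
  symmetry matters twice: the cube is closed under negation, and \<open>\<bar>d i \<bullet> s\<bar> / (2 * r + 1)\<close> stays
  below \<open>1 / 2\<close>, the range in which \<open>1 - cos (2 * \<pi> * t)\<close> is comparable to \<open>t\<^sup>2\<close>.
\<close>

lemma cube_representative:
  assumes "v \<in> lat"
  shows "\<exists>!s\<in>cube r. (v - s) /\<^sub>R (2 * real r + 1) \<in> lat"
proof (rule ex_ex1I)
  define N where "N = 2 * int r + 1"
  have N: "N > 0" "real_of_int N = 2 * real r + 1" by (auto simp: N_def)
  define k where "k i = (\<lfloor>d i \<bullet> v\<rfloor> + int r) mod N - int r" for i
  define s where "s = (\<Sum>i\<in>I. of_int (k i) *\<^sub>R e i)"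
  have s: "d i \<bullet> s = of_int (k i)" if "i \<in> I" for i
    using that by (simp add: s_def coord_comb)
  have k: "\<bar>k i\<bar> \<le> int r" for i
    using pos_mod_bound[OF N(1), of "\<lfloor>d i \<bullet> v\<rfloor> + int r"]
      pos_mod_sign[OF N(1), of "\<lfloor>d i \<bullet> v\<rfloor> + int r"]
    unfolding k_def N_def by linarith
  then have "\<bar>real_of_int (k i)\<bar> \<le> real r" for i
    by (metis of_int_abs of_int_le_iff of_int_of_nat_eq)
  then have "s \<in> cube r" by (auto simp: cube_def lat_def s)
  moreover have "(v - s) /\<^sub>R (2 * real r + 1) \<in> lat"
    unfolding lat_def
  proof (intro CollectI ballI)
    fix i assume i: "i \<in> I"
    then have "d i \<bullet> v = of_int \<lfloor>d i \<bullet> v\<rfloor>" using assms by (auto simp: lat_def elim: Ints_cases)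
    moreover have "\<lfloor>d i \<bullet> v\<rfloor> - k i = N * ((\<lfloor>d i \<bullet> v\<rfloor> + int r) div N)"
      unfolding k_def by (simp add: minus_mod_eq_mult_div[symmetric])
    then have "real_of_int (\<lfloor>d i \<bullet> v\<rfloor> - k i) = (2 * real r + 1) * of_int ((\<lfloor>d i \<bullet> v\<rfloor> + int r) div N)"
      by (metis N(2) of_int_mult)
    ultimately have "d i \<bullet> (v - s) = (2 * real r + 1) * of_int ((\<lfloor>d i \<bullet> v\<rfloor> + int r) div N)"
      using i by (simp add: inner_diff_right s)
    then have "d i \<bullet> ((v - s) /\<^sub>R (2 * real r + 1)) = of_int ((\<lfloor>d i \<bullet> v\<rfloor> + int r) div N)"
      unfolding inner_scaleR_right using N(1) by (simp flip: N(2))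
    then show "d i \<bullet> ((v - s) /\<^sub>R (2 * real r + 1)) \<in> \<int>" by (metis Ints_of_int)
  qed
  ultimately show "\<exists>s. s \<in> cube r \<and> (v - s) /\<^sub>R (2 * real r + 1) \<in> lat" by blast
next
  fix s t assume s: "s \<in> cube r \<and> (v - s) /\<^sub>R (2 * real r + 1) \<in> lat"
    and t: "t \<in> cube r \<and> (v - t) /\<^sub>R (2 * real r + 1) \<in> lat"
  show "s = t"
  proof (rule coord_eqI)
    fix i assume i: "i \<in> I"
    have "(v - t) /\<^sub>R (2 * real r + 1) - (v - s) /\<^sub>R (2 * real r + 1) \<in> lat"
      using s t lat_diff by blast
    then have "d i \<bullet> ((v - t) /\<^sub>R (2 * real r + 1) - (v - s) /\<^sub>R (2 * real r + 1)) \<in> \<int>"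
      using i by (simp add: lat_def)
    then have "(d i \<bullet> s - d i \<bullet> t) / (2 * real r + 1) \<in> \<int>"
      by (simp add: inner_diff_right divide_inverse algebra_simps)
    then obtain m :: int where m: "(d i \<bullet> s - d i \<bullet> t) / (2 * real r + 1) = of_int m"
      by (auto elim: Ints_cases)
    have "\<bar>d i \<bullet> s\<bar> \<le> r" "\<bar>d i \<bullet> t\<bar> \<le> r" using s t i by (auto simp: cube_def)
    then have "\<bar>d i \<bullet> s - d i \<bullet> t\<bar> < 2 * real r + 1" by linarith
    then have "\<bar>(d i \<bullet> s - d i \<bullet> t) / (2 * real r + 1)\<bar> < 1"
      by (simp add: abs_if field_simps split: if_splits)
    then have "m = 0" unfolding m by linarith
    then show "d i \<bullet> s = d i \<bullet> t" using m by simp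
  qed
qed

end

lemma (in dual_bases) lat_neq_UNIV: "lat \<noteq> UNIV"
proof
  assume "lat = UNIV"
  have "I \<noteq> {}"
  proof
    assume "I = {}"
    then have "x = 0" for x :: 'a using expand[of x] by simp
    then show False by (metis SOME_Basis nonzero_Basis)
  qed
  then obtain i where i: "i \<in> I" by blast
  have "(1 / 2) *\<^sub>R e i \<in> lat" using \<open>lat = UNIV\<close> by simp
  then have "1 / 2 \<in> (\<int> :: real set)"
    using i biorthogonal[OF i i] unfolding lat_def by fastforce
  then obtain m :: int where "1 / 2 = real_of_int m" by (rule Ints_cases)
  then have "real_of_int (2 * m) = real_of_int 1" by simp
  then have "2 * m = 1" by (simp only: of_int_eq_iff)
  then show False by presburger
qed

section \<open>Fourier analysis on a finite quotient of lattices\<close>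

text \<open>
  Summing a periodic function over a set of representatives is summing it over the quotient
  group, where translations are bijections. \<open>M\<close> is the group, and \<open>R\<close> is membership in the
  subgroup of periods.
\<close>

lemma sum_over_representatives:
  fixes h :: "'a::ab_group_add \<Rightarrow> 'b::real_vector"
  assumes rep: "\<And>x. x \<in> M \<Longrightarrow> \<exists>!s\<in>S. R (x - s)"
    and S: "S \<subseteq> M" and M: "\<And>x y. x \<in> M \<Longrightarrow> y \<in> M \<Longrightarrow> x - y \<in> M"
    and R: "\<And>x. R x \<Longrightarrow> R (- x)"
    and h: "\<And>x y. R (x - y) \<Longrightarrow> h x = h y"
    and k: "k \<in> M"
  shows "(\<Sum>s\<in>S. h (s + k)) = (\<Sum>s\<in>S. h s)"
proof -
  have M': "x + y \<in> M" if "x \<in> M" "y \<in> M" for x y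
    using M[OF that(1) M[OF M[OF that(2) that(2)] that(2)]] by simp
  define p where "p x = (THE s. s \<in> S \<and> R (x - s))" for x
  have p: "p x \<in> S" "R (x - p x)" if "x \<in> M" for x
    using theI'[OF rep[OF that]] by (auto simp: p_def)
  have pI: "p x = s" if "x \<in> M" "s \<in> S" "R (x - s)" for x s
    using rep[OF that(1)] p[OF that(1)] that by blast
  have sM: "s + k \<in> M" "s - k \<in> M" if "s \<in> S" for s
    using that S k M M' by auto
  show ?thesis
  proof (rule sum.reindex_bij_witness[where i = "\<lambda>s. p (s - k)" and j = "\<lambda>s. p (s + k)"])
    fix s assume s: "s \<in> S"
    note a = p[OF sM(1)[OF s]] and b = p[OF sM(2)[OF s]]
    show "p (s + k) \<in> S" "p (s - k) \<in> S" using a b by auto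
    show "p (p (s + k) - k) = s"
      using R[OF a(2)] by (intro pI sM a s) (simp add: algebra_simps)
    show "p (p (s - k) + k) = s"
      using R[OF b(2)] by (intro pI sM b s) (simp add: algebra_simps)
    show "h (p (s + k)) = h (s + k)" using h[OF a(2)] by simp
  qed
qed

context dual_bases
begin

interpretation dual: dual_bases I d e by (rule swap)

lemma inner_dual_lat: "u \<in> dual.lat \<Longrightarrow> v \<in> lat \<Longrightarrow> u \<bullet> v \<in> \<int>"
  by (rule inner_dual_Ints) (auto simp: dual.lat_def inner_commute)

text \<open>
  Orthogonality of characters. If \<open>v\<close> is not a multiple of \<open>2 * r + 1\<close> in the lattice, some dual
  basis vector takes a nonintegral value at \<open>v /\<^sub>R (2 * r + 1)\<close>; translating the summation
  variable by that vector multiplies the exponential sum by a root of unity other than \<open>1\<close>.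
\<close>

lemma sum_cos_dual_cube:
  assumes v: "v \<in> lat"
  shows "(\<Sum>u\<in>dual.cube r. cos (2 * pi * (u \<bullet> v) / (2 * real r + 1))) =
         (if v /\<^sub>R (2 * real r + 1) \<in> lat then real (card (dual.cube r)) else 0)"
proof -
  define N where "N = 2 * real r + 1"
  have N: "N > 0" by (simp add: N_def)
  have scale: "2 * pi * (u \<bullet> v) / N = 2 * pi * (u \<bullet> (v /\<^sub>R N))" for u
    by (simp add: field_simps)
  show ?thesis
  proof (cases "v /\<^sub>R N \<in> lat")
    case True
    have "cos (2 * pi * (u \<bullet> v) / N) = 1" if "u \<in> dual.cube r" for u
    proof -
      have "u \<bullet> (v /\<^sub>R N) \<in> \<int>" by (rule inner_dual_lat[OF dual.cube_lat[OF that] True])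
      then obtain m :: int where "u \<bullet> (v /\<^sub>R N) = of_int m" by (rule Ints_cases)
      then show ?thesis unfolding scale by (simp only: cos_int_2pin)
    qed
    then show ?thesis using True by (simp add: N_def)
  next
    case False
    then obtain i where i: "i \<in> I" "d i \<bullet> (v /\<^sub>R N) \<notin> \<int>" by (auto simp: lat_def)
    define h where "h u = cis (2 * pi * (u \<bullet> v) / N)" for u
    have add: "h (x + y) = h x * h y" for x y
      by (simp add: h_def cis_mult inner_add_left add_divide_distrib distrib_left)
    have one: "h x = 1" if x: "x /\<^sub>R N \<in> dual.lat" for x
    proof -
      have "x \<bullet> v / N = (x /\<^sub>R N) \<bullet> v" by (simp add: divide_inverse mult.commute)
      then have "x \<bullet> v / N \<in> \<int>" using inner_dual_lat[OF x v] by simp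
      then obtain m :: int where "x \<bullet> v / N = of_int m" by (rule Ints_cases)
      then have "2 * pi * (x \<bullet> v) / N = 2 * pi * of_int m" by (simp only: times_divide_eq_right[symmetric])
      then show ?thesis unfolding h_def by (simp only:) (simp add: complex_eq_iff cos_int_2pin sin_int_2pin)
    qed
    have "(\<Sum>u\<in>dual.cube r. h (u + d i)) = (\<Sum>u\<in>dual.cube r. h u)"
    proof (rule sum_over_representatives[where M = dual.lat and R = "\<lambda>x. x /\<^sub>R N \<in> dual.lat"])
      show "x \<in> dual.lat \<Longrightarrow> \<exists>!s\<in>dual.cube r. (x - s) /\<^sub>R N \<in> dual.lat" for x
        unfolding N_def by (rule dual.cube_representative)
      show "h x = h y" if "(x - y) /\<^sub>R N \<in> dual.lat" for x y
        using add[of "x - y" y] one[OF that] by simp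
      show "- x /\<^sub>R N \<in> dual.lat" if "x /\<^sub>R N \<in> dual.lat" for x
        using dual.lat_minus[OF that] by simp
    qed (use dual.cube_lat dual.lat_diff dual.basis_in_lat i in auto)
    then have "(\<Sum>u\<in>dual.cube r. h u) * h (d i) = (\<Sum>u\<in>dual.cube r. h u)"
      by (simp only: add sum_distrib_right)
    then have "(\<Sum>u\<in>dual.cube r. h u) * (h (d i) - 1) = 0"
      by (simp add: right_diff_distrib)
    moreover have "h (d i) \<noteq> 1"
    proof
      assume "h (d i) = 1"
      then have "cos (2 * pi * (d i \<bullet> (v /\<^sub>R N))) = 1"
        unfolding h_def scale by (metis cis.simps(1) one_complex.simps(1))
      then obtain m :: int where "2 * pi * (d i \<bullet> (v /\<^sub>R N)) = of_int m * 2 * pi"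
        by (auto simp: cos_one_2pi_int)
      then have "d i \<bullet> (v /\<^sub>R N) = of_int m" by simp
      then show False using i by simp
    qed
    ultimately have "(\<Sum>u\<in>dual.cube r. h u) = 0" by simp
    then have "(\<Sum>u\<in>dual.cube r. Re (h u)) = 0" by (metis Re_sum zero_complex.simps(1))
    then show ?thesis using False by (simp add: h_def N_def)
  qed
qed

text \<open>
  The form \<open>g\<close> stands for the real part of a Gram matrix on the finite group \<open>lat / N lat\<close>, and
  \<open>K\<close> for the squared distances that it defines. The right-hand side of the last claim is the
  average of \<open>K\<close> over all pairs whose difference is \<open>v\<close> or \<open>- v\<close>; such an invariant average is a
  combination of the functions \<open>1 - cos\<close>. The coefficients \<open>w\<close> are nonnegative because they are
  values of the quadratic form \<open>g\<close> at the vectors of cosines and of sines.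
\<close>

lemma finite_fourier:
  fixes g :: "'a \<Rightarrow> 'a \<Rightarrow> real" and r :: nat
  defines "N \<equiv> 2 * real r + 1"
  assumes sym: "\<And>v w. g v w = g w v"
    and per: "\<And>v v' w. (v - v') /\<^sub>R N \<in> lat \<Longrightarrow> g v w = g v' w"
    and pos: "\<And>a. 0 \<le> (\<Sum>s\<in>cube r. \<Sum>t\<in>cube r. a s * a t * g s t)"
  defines "w \<equiv> \<lambda>u. (\<Sum>s\<in>cube r. \<Sum>t\<in>cube r. cos (2 * pi * (u \<bullet> (s - t)) / N) * g s t) /
                    (real (card (cube r)) * real (card (dual.cube r)))"
    and "K \<equiv> \<lambda>v v'. g v v + g v' v' - 2 * g v v'"
  shows "0 \<le> w u" "w (- u) = w u"
    and "v \<in> lat \<Longrightarrow> 2 * (\<Sum>u\<in>dual.cube r. w u * (1 - cos (2 * pi * (u \<bullet> v) / N))) =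
      (\<Sum>s\<in>cube r. K s (s + v) + K s (s - v)) / (2 * real (card (cube r)))"
proof -
  show "w (- u) = w u" by (simp add: w_def)
  show "0 \<le> w u"
  proof -
    have "cos (2 * pi * (u \<bullet> (s - t)) / N) =
        cos (2 * pi * (u \<bullet> s) / N) * cos (2 * pi * (u \<bullet> t) / N) +
        sin (2 * pi * (u \<bullet> s) / N) * sin (2 * pi * (u \<bullet> t) / N)" for s t
      by (simp add: inner_diff_right right_diff_distrib diff_divide_distrib cos_diff)
    then show ?thesis
      unfolding w_def
      using pos[of "\<lambda>s. cos (2 * pi * (u \<bullet> s) / N)"] pos[of "\<lambda>s. sin (2 * pi * (u \<bullet> s) / N)"]
      by (auto simp: distrib_right sum.distrib intro!: divide_nonneg_nonneg)
  qed
  assume v: "v \<in> lat"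
  let ?S = "cube r" and ?U = "dual.cube r"
  define n m where "n = real (card ?S)" and "m = real (card ?U)"
  have nm: "n > 0" "m > 0"
    using cube_0[of r] dual.cube_0[of r] finite_cube[of r] dual.finite_cube[of r]
    by (auto simp: n_def m_def card_gt_0_iff)
  define c where "c u x = cos (2 * pi * (u \<bullet> x) / N)" for u x :: 'a
  define E where "E x = (\<Sum>u\<in>?U. c u x)" for x
  have E: "E x = (if x /\<^sub>R N \<in> lat then m else 0)" if "x \<in> lat" for x
    using sum_cos_dual_cube[OF that, of r] by (simp add: E_def c_def m_def N_def)
  \<comment> \<open>By orthogonality, summing over the dual cube selects the single \<open>t\<close> congruent to \<open>s + x\<close>.\<close>
  have pick: "(\<Sum>t\<in>?S. g s t * E (s - t + x)) = m * g s (s + x)" if s: "s \<in> ?S" and x: "x \<in> lat" for s x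
  proof -
    have sx: "s + x \<in> lat" using s x cube_lat lat_add by blast
    obtain t0 where t0: "t0 \<in> ?S" "(s + x - t0) /\<^sub>R N \<in> lat"
      and uniq: "\<And>t. t \<in> ?S \<Longrightarrow> (s + x - t) /\<^sub>R N \<in> lat \<Longrightarrow> t = t0"
      using cube_representative[OF sx, of r] unfolding N_def by blast
    have "(\<Sum>t\<in>?S. g s t * E (s - t + x)) = (\<Sum>t\<in>?S. if t = t0 then m * g s t0 else 0)"
    proof (rule sum.cong[OF refl])
      fix t assume t: "t \<in> ?S"
      have eq: "s - t + x = s + x - t" by simp
      have "E (s + x - t) = (if (s + x - t) /\<^sub>R N \<in> lat then m else 0)"
        using sx t cube_lat lat_diff by (intro E) blast
      moreover have "(s + x - t) /\<^sub>R N \<in> lat \<longleftrightarrow> t = t0" using t0 uniq[OF t] by blast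
      ultimately show "g s t * E (s - t + x) = (if t = t0 then m * g s t0 else 0)"
        unfolding eq by (cases "t = t0") simp_all
    qed
    also have "\<dots> = m * g s t0" using t0 finite_cube by simp
    also have "g s t0 = g s (s + x)" using per[OF t0(2), of s] sym by metis
    finally show ?thesis .
  qed
  \<comment> \<open>The diagonal terms of \<open>K\<close> are shifted by \<open>v\<close>, which does not change their sum.\<close>
  have shift: "(\<Sum>s\<in>?S. g (s + x) (s + x)) = (\<Sum>s\<in>?S. g s s)" if x: "x \<in> lat" for x
  proof (rule sum_over_representatives[where M = lat and R = "\<lambda>x. x /\<^sub>R N \<in> lat"
        and h = "\<lambda>s. g s s"])
    show "x \<in> lat \<Longrightarrow> \<exists>!s\<in>cube r. (x - s) /\<^sub>R N \<in> lat" for x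
      unfolding N_def by (rule cube_representative)
    show "g x x = g y y" if "(x - y) /\<^sub>R N \<in> lat" for x y
      using per[OF that] sym by metis
    show "- x /\<^sub>R N \<in> lat" if "x /\<^sub>R N \<in> lat" for x
      using lat_minus[OF that] by simp
  qed (use cube_lat lat_diff x in auto)
  have prod: "c u y * (1 - c u v) = c u (y + 0) - (c u (y + v) + c u (y + - v)) / 2" for u y
  proof -
    define \<alpha> where "\<alpha> x = 2 * pi * (u \<bullet> x) / N" for x
    have "\<alpha> (y + x) = \<alpha> y + \<alpha> x" "\<alpha> (y - x) = \<alpha> y - \<alpha> x" for x y
      by (simp_all add: \<alpha>_def inner_add_right inner_diff_right distrib_left right_diff_distrib
          add_divide_distrib diff_divide_distrib)
    moreover have "c u x = cos (\<alpha> x)" for x by (simp only: c_def \<alpha>_def)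
    ultimately show ?thesis
      by (simp add: cos_add cos_diff) (simp add: algebra_simps)
  qed
  have "n * m * (\<Sum>u\<in>?U. w u * (1 - c u v)) =
      (\<Sum>u\<in>?U. \<Sum>s\<in>?S. \<Sum>t\<in>?S. g s t * (c u (s - t) * (1 - c u v)))"
    using nm unfolding w_def n_def[symmetric] m_def[symmetric] c_def[symmetric]
    by (simp add: sum_distrib_left sum_distrib_right sum_divide_distrib mult_ac)
  also have "\<dots> = (\<Sum>s\<in>?S. \<Sum>t\<in>?S. \<Sum>u\<in>?U. g s t * (c u (s - t) * (1 - c u v)))"
    by (subst sum.swap) (intro sum.cong refl sum.swap)
  also have "\<dots> = (\<Sum>s\<in>?S. \<Sum>t\<in>?S. g s t * E (s - t + 0) -
      (g s t * E (s - t + v) + g s t * E (s - t + - v)) / 2)"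
  proof (intro sum.cong refl)
    fix s t
    have "(\<Sum>u\<in>?U. g s t * (c u (s - t) * (1 - c u v))) =
        g s t * (\<Sum>u\<in>?U. c u (s - t + 0) - (c u (s - t + v) + c u (s - t + - v)) / 2)"
      unfolding prod by (rule sum_distrib_left[symmetric])
    also have "\<dots> = g s t * (E (s - t + 0) - (E (s - t + v) + E (s - t + - v)) / 2)"
      by (simp only: E_def sum_subtractf sum.distrib sum_divide_distrib add_divide_distrib)
    finally show "(\<Sum>u\<in>?U. g s t * (c u (s - t) * (1 - c u v))) =
        g s t * E (s - t + 0) - (g s t * E (s - t + v) + g s t * E (s - t + - v)) / 2"
      by (simp only: right_diff_distrib distrib_left times_divide_eq_right)
  qed
  also have "\<dots> = (\<Sum>s\<in>?S. m * g s (s + 0) - (m * g s (s + v) + m * g s (s + - v)) / 2)"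
    unfolding sum_subtractf sum.distrib sum_divide_distrib[symmetric]
    by (intro arg_cong2[where f = "(-)"] arg_cong2[where f = "(/)"] arg_cong2[where f = "(+)"]
        sum.cong refl pick lat_0 lat_minus v)
  also have "\<dots> = m / 4 * (\<Sum>s\<in>?S. K s (s + v) + K s (s - v))"
  proof -
    have eq: "(\<Sum>s\<in>?S. K s (s + v) + K s (s - v)) = 4 * (\<Sum>s\<in>?S. g s s) -
        2 * (\<Sum>s\<in>?S. g s (s + v)) - 2 * (\<Sum>s\<in>?S. g s (s - v))"
      using shift[OF v] shift[OF lat_minus[OF v]]
      by (simp add: K_def sum.distrib sum_subtractf sum_distrib_left)
    show ?thesis unfolding eq
      by (simp add: sum_subtractf sum.distrib sum_distrib_left[symmetric]
          sum_divide_distrib[symmetric] algebra_simps)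
  qed
  finally have "n * m * (\<Sum>u\<in>?U. w u * (1 - c u v)) =
      m / 4 * (\<Sum>s\<in>?S. K s (s + v) + K s (s - v))" .
  then have "2 * (\<Sum>u\<in>?U. w u * (1 - c u v)) = (\<Sum>s\<in>?S. K s (s + v) + K s (s - v)) / (2 * n)"
    using nm by (simp add: field_simps)
  then show "2 * (\<Sum>u\<in>?U. w u * (1 - cos (2 * pi * (u \<bullet> v) / N))) =
      (\<Sum>s\<in>?S. K s (s + v) + K s (s - v)) / (2 * real (card ?S))"
    by (simp add: c_def n_def)
qed

end

section \<open>The flat torus\<close>

definition torus_point :: "(real^'n) set \<Rightarrow> real^'n \<Rightarrow> (real^'n) set" where
  "torus_point L x = {y. x - y \<in> L}"

lemma torus_eq_range: "torus L = range (torus_point L)"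
  by (auto simp: torus_def quotient_def torus_point_def)

text \<open>
  The dual basis consists of the vectors that represent the coordinate functionals of the
  lattice basis.
\<close>

lemma lattice_dual_bases:
  fixes L :: "(real^'n) set"
  assumes "is_lattice L"
  obtains B d where "dual_bases B (\<lambda>b. b) d" "L = dual_bases.lat B d"
    "dual_lattice L = dual_bases.lat B (\<lambda>b. b)"
proof -
  from assms obtain B :: "(real^'n) set" where ind: "independent B" and span: "span B = UNIV"
    and L: "L = range (\<lambda>k :: real^'n \<Rightarrow> int. \<Sum>b\<in>B. of_int (k b) *\<^sub>R b)"
    unfolding is_lattice_def by blast
  have fin: "finite B" using ind by (rule independent_imp_finite)
  define d where "d b = (\<Sum>i\<in>Basis. representation B i b *\<^sub>R i)" for b :: "real^'n"
  have d: "d b \<bullet> x = representation B x b" for b x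
  proof -
    have "representation B x b = representation B (\<Sum>i\<in>Basis. (x \<bullet> i) *\<^sub>R i) b"
      by (simp add: euclidean_representation)
    also have "\<dots> = (\<Sum>i\<in>Basis. (x \<bullet> i) * representation B i b)"
      using ind span by (simp add: representation_sum representation_scale)
    also have "\<dots> = d b \<bullet> x"
      by (simp add: d_def inner_sum_left inner_sum_right inner_commute mult.commute)
    finally show ?thesis by simp
  qed
  interpret dual_bases B "\<lambda>b. b" d
  proof
    show "x = (\<Sum>b\<in>B. (d b \<bullet> x) *\<^sub>R b)" for x
      unfolding d using ind span fin by (simp add: sum_representation_eq)
  qed (auto simp: d fin representation_basis[OF ind])
  interpret dual: dual_bases B d "\<lambda>b. b" by (rule swap)
  have lat: "L = lat" by (simp add: L lat_eq)
  have "dual_lattice L = dual.lat"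
  proof (intro equalityI subsetI)
    fix u assume "u \<in> dual_lattice L"
    then have "u \<bullet> b \<in> \<int>" if "b \<in> B" for b
      using basis_in_lat[OF that] by (simp add: dual_lattice_def lat)
    then show "u \<in> dual.lat" by (simp add: dual.lat_def inner_commute[of _ u])
  next
    fix u assume "u \<in> dual.lat"
    then have "u \<bullet> b \<in> \<int>" if "b \<in> B" for b
      using that by (simp add: dual.lat_def inner_commute[of u])
    then show "u \<in> dual_lattice L"
      by (simp add: dual_lattice_def lat inner_dual_Ints)
  qed
  then show thesis using that lat dual_bases_axioms by blast
qed

text \<open>
  The metric of the torus depends only on \<open>L\<close> being a closed subgroup: the distance of two
  cosets is the distance of a difference of representatives to \<open>L\<close>, and closedness makes it
  attained. Reducing a vector by a nearest element of \<open>L\<close> lands in the Voronoi cell.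
\<close>

locale closed_subgroup =
  fixes L :: "(real^'n) set"
  assumes closed: "closed L" and zero: "0 \<in> L" and diff: "\<lbrakk>v \<in> L; w \<in> L\<rbrakk> \<Longrightarrow> v - w \<in> L"
begin

lemma uminus: "v \<in> L \<Longrightarrow> - v \<in> L"
  using diff[OF zero] by simp

lemma add: "v \<in> L \<Longrightarrow> w \<in> L \<Longrightarrow> v + w \<in> L"
  using diff[of v "- w"] uminus[of w] by simp

lemma torus_point_eq_iff: "torus_point L x = torus_point L y \<longleftrightarrow> x - y \<in> L"
proof
  assume "torus_point L x = torus_point L y"
  moreover have "y \<in> torus_point L y" using zero by (simp add: torus_point_def)
  ultimately have "y \<in> torus_point L x" by simp
  then show "x - y \<in> L" by (simp add: torus_point_def)
next
  assume xy: "x - y \<in> L"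
  have "x - v \<in> L \<longleftrightarrow> y - v \<in> L" for v
  proof
    show "y - v \<in> L" if "x - v \<in> L" using diff[OF that xy] by simp
    show "x - v \<in> L" if "y - v \<in> L" using add[OF xy that] by simp
  qed
  then show "torus_point L x = torus_point L y" by (simp add: torus_point_def)
qed

lemma torus_dist_point: "torus_dist L (torus_point L x) (torus_point L y) = infdist (x - y) L"
proof -
  have "{norm (x' - y' - v) | x' y' v. x' \<in> torus_point L x \<and> y' \<in> torus_point L y \<and> v \<in> L} =
      dist (x - y) ` L" (is "?A = _")
  proof (intro equalityI subsetI)
    fix a assume "a \<in> ?A"
    then obtain x' y' v where a: "a = norm (x' - y' - v)" "x - x' \<in> L" "y - y' \<in> L" "v \<in> L"
      by (auto simp: torus_point_def)
    then have "a = dist (x - y) ((x - x') - (y - y') + v)"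
      by (simp add: dist_norm algebra_simps)
    moreover have "(x - x') - (y - y') + v \<in> L" using a diff add by blast
    ultimately show "a \<in> dist (x - y) ` L" by blast
  next
    fix a assume "a \<in> dist (x - y) ` L"
    then show "a \<in> ?A" using zero by (force simp: dist_norm torus_point_def)
  qed
  then show ?thesis using zero by (auto simp: torus_dist_def infdist_def)
qed

lemma infdist_uminus: "infdist (- x) L = infdist x L"
proof -
  have le: "infdist (- x) L \<le> infdist x L" for x
  proof -
    obtain v where v: "v \<in> L" "infdist x L = dist x v"
      using infdist_attains_inf[OF closed] zero by blast
    have "infdist (- x) L \<le> dist (- x) (- v)" by (intro infdist_le uminus v)
    then show ?thesis using v by (simp add: dist_norm norm_minus_commute)
  qed
  show ?thesis using le[of x] le[of "- x"] by simp
qed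

lemma infdist_le_norm: "infdist x L \<le> norm x"
  using infdist_le[OF zero, of x] by simp

lemma infdist_voronoi:
  assumes "x \<in> voronoi_cell L"
  shows "infdist x L = norm x"
proof -
  obtain v where "v \<in> L" "infdist x L = dist x v"
    using infdist_attains_inf[OF closed] zero by blast
  then have "norm x \<le> infdist x L" using assms by (simp add: voronoi_cell_def dist_norm)
  then show ?thesis using infdist_le_norm[of x] by simp
qed

lemma voronoi_reduce:
  obtains v where "v \<in> L" "x - v \<in> voronoi_cell L" "infdist x L = norm (x - v)"
proof -
  obtain v where v: "v \<in> L" "infdist x L = dist x v"
    using infdist_attains_inf[OF closed] zero by blast
  have "norm (x - v) \<le> norm (x - v - w)" if "w \<in> L" for w
    using infdist_le[OF add[OF v(1) that], of x] v by (simp add: dist_norm algebra_simps)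
  then show thesis using that[of v] v by (simp add: voronoi_cell_def dist_norm)
qed

end

lemma closed_subgroup_lat:
  assumes "dual_bases I e d" "L = dual_bases.lat I d"
  shows "closed_subgroup L"
proof -
  interpret dual_bases I e d by (rule assms)
  show ?thesis by (simp add: closed_subgroup_def assms(2) closed_lat lat_0 lat_diff)
qed

section \<open>From an embedding to weights on the dual lattice\<close>

context complex_inner_space
begin

lemma minus_eq_zeroD:
  assumes "x \<in> carrier H" "y \<in> carrier H" "x \<ominus> y = \<zero>"
  shows "x = y"
proof -
  have "\<ominus> (\<ominus> y) = x"
    using assms by (intro M.minus_equality) (auto simp: a_minus_def)
  then show ?thesis using assms by simp
qed

lemma hdist_square:
  assumes "x \<in> carrier H" "y \<in> carrier H"
  shows "(hdist H x y)\<^sup>2 = Re (cinner H x x) + Re (cinner H y y) - 2 * Re (cinner H x y)"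
proof -
  have "(hdist H x y)\<^sup>2 = Re (cinner H (x \<ominus> y) (x \<ominus> y))"
    using hnorm_square[of "x \<ominus> y"] assms by (simp add: hdist_def minus_eq_smult)
  then show ?thesis
    using assms cinner_cnj[of x y]
    by (simp add: minus_eq_smult cinner_add_left cinner_add_right cinner_smult_left cinner_smult_right)
qed

text \<open>
  The double sum is the squared norm of \<open>\<Sum>s\<in>S. a s \<odot> \<Phi> s\<close>. That vector is not written down;
  a vector with the same inner products is obtained by induction on \<open>S\<close>.
\<close>

lemma gram_nonneg:
  fixes a :: "'i \<Rightarrow> real"
  assumes S: "finite S" "\<And>s. s \<in> S \<Longrightarrow> \<Phi> s \<in> carrier H"
  shows "0 \<le> (\<Sum>s\<in>S. \<Sum>t\<in>S. a s * a t * Re (cinner H (\<Phi> s) (\<Phi> t)))"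
proof -
  have "\<exists>v\<in>carrier H. \<forall>y\<in>carrier H. cinner H y v = (\<Sum>t\<in>S. of_real (a t) * cinner H y (\<Phi> t))"
    using S
  proof (induction S rule: finite_induct)
    case empty
    show ?case by (intro bexI[of _ \<zero>]) auto
  next
    case (insert s S)
    then obtain v where v: "v \<in> carrier H"
      "\<And>y. y \<in> carrier H \<Longrightarrow> cinner H y v = (\<Sum>t\<in>S. of_real (a t) * cinner H y (\<Phi> t))" by auto
    show ?case
      by (rule bexI[of _ "of_real (a s) \<odot> \<Phi> s \<oplus> v"])
        (use insert v in \<open>auto simp: cinner_add_right cinner_smult_right\<close>)
  qed
  then obtain v where v: "v \<in> carrier H"
    "\<And>y. y \<in> carrier H \<Longrightarrow> cinner H y v = (\<Sum>t\<in>S. of_real (a t) * cinner H y (\<Phi> t))" by blast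
  have "cinner H v (\<Phi> t) = (\<Sum>s\<in>S. of_real (a s) * cinner H (\<Phi> s) (\<Phi> t))" if t: "t \<in> S" for t
    using cinner_cnj[of "\<Phi> t" v] v S(2) t cinner_cnj[of "\<Phi> t"]
    by (simp add: cong: sum.cong)
  then have "cinner H v v = (\<Sum>t\<in>S. \<Sum>s\<in>S. of_real (a s * a t) * cinner H (\<Phi> s) (\<Phi> t))"
    using v by (simp add: sum_distrib_left mult_ac cong: sum.cong)
  then have "Re (cinner H v v) = (\<Sum>t\<in>S. \<Sum>s\<in>S. a s * a t * Re (cinner H (\<Phi> s) (\<Phi> t)))"
    by simp
  also have "\<dots> = (\<Sum>s\<in>S. \<Sum>t\<in>S. a s * a t * Re (cinner H (\<Phi> s) (\<Phi> t)))"
    by (rule sum.swap)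
  finally show ?thesis
    using cinner_self_ge[OF v(1)] by (simp add: less_eq_complex_def)
qed

end

text \<open>
  Both suprema in the distortion are positive, because \<open>L\<close> is not the whole space and so the
  torus has two points. Their product being finite, both are finite, and rescaling the
  embedding by the second one makes it noncontracting with Lipschitz constant \<open>D\<close>.
\<close>

lemma finite_distortion:
  fixes L :: "(real^'n) set"
  assumes L: "closed_subgroup L" "L \<noteq> UNIV" and emb: "euclidean_embedding L H \<phi>"
    and D: "distortion L H \<phi> = ennreal D" "0 \<le> D"
  obtains q where "0 \<le> q"
    "\<And>x y. infdist (x - y) L \<le> q * hdist H (\<phi> (torus_point L x)) (\<phi> (torus_point L y))"
    "\<And>x y. q * hdist H (\<phi> (torus_point L x)) (\<phi> (torus_point L y)) \<le> D * infdist (x - y) L"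
proof -
  interpret closed_subgroup L by (rule L)
  interpret H: complex_hilbert_space H using emb by (simp add: euclidean_embedding_def)
  define h where "h x y = hdist H (\<phi> (torus_point L x)) (\<phi> (torus_point L y))" for x y
  have carr: "\<phi> (torus_point L x) \<in> carrier H" for x
    using emb by (auto simp: euclidean_embedding_def torus_eq_range)
  have inj: "\<phi> (torus_point L x) = \<phi> (torus_point L y) \<longleftrightarrow> x - y \<in> L" for x y
    using emb by (auto simp: euclidean_embedding_def torus_eq_range torus_point_eq_iff[symmetric] inj_on_def)
  have h0: "h x y = 0" if "x - y \<in> L" for x y
    using H.hdist_square[OF carr carr, of x y] inj[of x y] that by (simp add: h_def)
  have hpos: "h x y > 0" if "x - y \<notin> L" for x y
  proof -
    have "\<phi> (torus_point L x) \<ominus>\<^bsub>H\<^esub> \<phi> (torus_point L y) \<noteq> \<zero>\<^bsub>H\<^esub>"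
      using inj[of x y] carr that H.minus_eq_zeroD by blast
    moreover have "\<phi> (torus_point L x) \<ominus>\<^bsub>H\<^esub> \<phi> (torus_point L y) \<in> carrier H"
      using carr by (simp add: H.minus_eq_smult)
    ultimately show ?thesis
      using H.hnorm_eq_0_iff H.hnorm_ge by (metis h_def hdist_def less_le)
  qed
  have dpos: "infdist x L > 0" if "x \<notin> L" for x
    using in_closed_iff_infdist_zero[OF closed, of x] zero that infdist_nonneg[of x L]
    by (auto simp: less_le)
  let ?T = "{(X, Y). X \<in> torus L \<and> Y \<in> torus L \<and> X \<noteq> Y}"
  define P where "P = (SUP (X, Y) \<in> ?T. ennreal (hdist H (\<phi> X) (\<phi> Y) / torus_dist L X Y))"
  define Q where "Q = (SUP (X, Y) \<in> ?T. ennreal (torus_dist L X Y / hdist H (\<phi> X) (\<phi> Y)))"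
  have PQ: "P * Q = ennreal D" using D by (simp add: distortion_def P_def Q_def)
  have P: "ennreal (h x y / infdist (x - y) L) \<le> P" if "x - y \<notin> L" for x y
    unfolding P_def
    by (rule SUP_upper2[of "(torus_point L x, torus_point L y)"])
      (use that in \<open>auto simp: torus_eq_range torus_point_eq_iff torus_dist_point h_def\<close>)
  have Q: "ennreal (infdist (x - y) L / h x y) \<le> Q" if "x - y \<notin> L" for x y
    unfolding Q_def
    by (rule SUP_upper2[of "(torus_point L x, torus_point L y)"])
      (use that in \<open>auto simp: torus_eq_range torus_point_eq_iff torus_dist_point h_def\<close>)
  obtain x0 where x0: "x0 \<notin> L" using L(2) by blast
  have "P > 0" "Q > 0"
    using P[of x0 0] Q[of x0 0] x0 hpos[of x0 0] dpos[of x0]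
    by (auto simp: intro: less_le_trans[rotated])
  moreover have "P * Q \<noteq> \<infinity>" using PQ by simp
  ultimately have fin: "P \<noteq> \<infinity>" "Q \<noteq> \<infinity>" by (auto simp: ennreal_mult_eq_top_iff)
  obtain p where p: "P = ennreal p" "0 \<le> p" using fin(1) by (cases P) auto
  obtain q where q: "Q = ennreal q" "0 \<le> q" using fin(2) by (cases Q) auto
  have pq: "p * q = D" using PQ p q D(2) by (simp add: ennreal_mult[symmetric])
  have "infdist (x - y) L \<le> q * h x y \<and> q * h x y \<le> D * infdist (x - y) L" for x y
  proof (cases "x - y \<in> L")
    case True
    then show ?thesis using h0[OF True] by simp
  next
    case False
    have "h x y / infdist (x - y) L \<le> p" "infdist (x - y) L / h x y \<le> q"
      using P[OF False] Q[OF False] p q by (auto simp: ennreal_le_iff)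
    then have "h x y \<le> p * infdist (x - y) L" "infdist (x - y) L \<le> q * h x y"
      using hpos[OF False] dpos[OF False] by (auto simp: pos_divide_le_eq)
    then show ?thesis
      using mult_left_mono[OF _ q(2), of "h x y" "p * infdist (x - y) L"]
      by (simp add: pq[symmetric] mult_ac)
  qed
  then show thesis using that[of q] q(2) by (simp add: h_def)
qed

text \<open>
  The Gram matrix of the rescaled embedding, restricted to \<open>(1/N) L\<close>, is averaged by
  \<open>finite_fourier\<close>. The bounds for the squared distances between \<open>s\<close> and \<open>s \<plusminus> v\<close> depend only on
  \<open>v\<close>, hence survive the averaging.
\<close>

lemma embedding_weights:
  fixes L :: "(real^'n) set" and r :: nat
  assumes B: "dual_bases I e d" "L = dual_bases.lat I d" "L \<noteq> UNIV"
    and emb: "euclidean_embedding L H \<phi>" and D: "distortion L H \<phi> = ennreal D" "0 \<le> D"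
  defines "U \<equiv> dual_bases.cube I e r" and "N \<equiv> 2 * real r + 1"
  obtains z where "\<And>u. 0 \<le> z u" "\<And>u. z (- u) = z u" "z 0 = 0" "\<And>u. u \<notin> U \<Longrightarrow> z u = 0"
    "\<And>v. v \<in> L \<Longrightarrow> (infdist (v /\<^sub>R N) L)\<^sup>2 \<le> 2 * (\<Sum>u\<in>U. z u * (1 - cos (2 * pi * (u \<bullet> (v /\<^sub>R N)))))"
    "\<And>v. v \<in> L \<Longrightarrow> 2 * (\<Sum>u\<in>U. z u * (1 - cos (2 * pi * (u \<bullet> (v /\<^sub>R N))))) \<le> (D * norm (v /\<^sub>R N))\<^sup>2"
proof -
  interpret dual_bases I e d by (rule B)
  interpret dual: dual_bases I d e by (rule swap)
  interpret closed_subgroup L by (rule closed_subgroup_lat[OF B(1,2)])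
  interpret H: complex_hilbert_space H using emb by (simp add: euclidean_embedding_def)
  have carr: "\<phi> (torus_point L x) \<in> carrier H" for x
    using emb by (auto simp: euclidean_embedding_def torus_eq_range)
  obtain q where q: "0 \<le> q"
    "\<And>x y. infdist (x - y) L \<le> q * hdist H (\<phi> (torus_point L x)) (\<phi> (torus_point L y))"
    "\<And>x y. q * hdist H (\<phi> (torus_point L x)) (\<phi> (torus_point L y)) \<le> D * infdist (x - y) L"
    using finite_distortion[OF closed_subgroup_axioms B(3) emb D] by metis
  define \<Phi> where "\<Phi> v = \<phi> (torus_point L (v /\<^sub>R N))" for v
  define g where "g v w = q\<^sup>2 * Re (cinner H (\<Phi> v) (\<Phi> w))" for v w
  define K where "K v w = g v v + g w w - 2 * g v w" for v w
  have \<Phi>: "\<Phi> v \<in> carrier H" for v by (simp add: \<Phi>_def carr)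
  have K: "K v w = (q * hdist H (\<Phi> v) (\<Phi> w))\<^sup>2" for v w
    unfolding K_def g_def power_mult_distrib H.hdist_square[OF \<Phi> \<Phi>]
    by (simp add: algebra_simps)
  have K_ge: "(infdist (v /\<^sub>R N) L)\<^sup>2 \<le> K s (s + v)" for s v
    using q(2)[of "s /\<^sub>R N" "(s + v) /\<^sub>R N"] infdist_uminus[of "v /\<^sub>R N"]
    unfolding K \<Phi>_def by (intro power_mono infdist_nonneg) (simp add: scaleR_add_right)
  have K_le: "K s (s + v) \<le> (D * norm (v /\<^sub>R N))\<^sup>2" for s v
  proof -
    have "q * hdist H (\<Phi> s) (\<Phi> (s + v)) \<le> D * infdist (v /\<^sub>R N) L"
      using q(3)[of "s /\<^sub>R N" "(s + v) /\<^sub>R N"] infdist_uminus[of "v /\<^sub>R N"]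
      by (simp add: \<Phi>_def scaleR_add_right)
    also have "\<dots> \<le> D * norm (v /\<^sub>R N)"
      by (intro mult_left_mono infdist_le_norm D)
    finally show ?thesis
      unfolding K using q(1) \<Phi> by (intro power_mono mult_nonneg_nonneg) (auto simp: hdist_def)
  qed
  have sym: "g v w = g w v" for v w
    using H.cinner_cnj[OF \<Phi> \<Phi>, of v w] by (simp add: g_def)
  have per: "g v w = g v' w" if "(v - v') /\<^sub>R N \<in> lat" for v v' w
  proof -
    have "torus_point L (v /\<^sub>R N) = torus_point L (v' /\<^sub>R N)"
      unfolding torus_point_eq_iff using that by (simp add: B(2) scaleR_diff_right)
    then show ?thesis by (simp add: g_def \<Phi>_def)
  qed
  have pos: "0 \<le> (\<Sum>s\<in>cube r. \<Sum>t\<in>cube r. a s * a t * g s t)" for a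
  proof -
    have "(\<Sum>s\<in>cube r. \<Sum>t\<in>cube r. a s * a t * g s t) =
        q\<^sup>2 * (\<Sum>s\<in>cube r. \<Sum>t\<in>cube r. a s * a t * Re (cinner H (\<Phi> s) (\<Phi> t)))"
      by (simp add: g_def sum_distrib_left mult_ac)
    then show ?thesis using H.gram_nonneg[of "cube r" \<Phi> a] finite_cube \<Phi> by simp
  qed
  note ff = finite_fourier[of g r, folded N_def, OF sym per pos, folded K_def U_def]
  define w where "w u = (\<Sum>s\<in>cube r. \<Sum>t\<in>cube r. cos (2 * pi * (u \<bullet> (s - t)) / N) * g s t) /
                    (real (card (cube r)) * real (card U))" for u
  \<comment> \<open>The weight at \<open>0\<close> is multiplied by \<open>1 - cos 0 = 0\<close>. It is discarded because the moment
    bound used for compactness does not control it.\<close>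
  define z where "z u = (if u \<in> U \<and> u \<noteq> 0 then w u else 0)" for u
  define n where "n = real (card (cube r))"
  have n: "n > 0"
    using cube_0[of r] finite_cube[of r] by (auto simp: n_def card_gt_0_iff)
  have zw: "2 * (\<Sum>u\<in>U. z u * (1 - cos (2 * pi * (u \<bullet> (v /\<^sub>R N))))) =
      (\<Sum>s\<in>cube r. K s (s + v) + K s (s - v)) / (2 * n)" if v: "v \<in> L" for v
  proof -
    have "(\<Sum>u\<in>U. z u * (1 - cos (2 * pi * (u \<bullet> (v /\<^sub>R N))))) =
        (\<Sum>u\<in>U. w u * (1 - cos (2 * pi * (u \<bullet> v) / N)))"
      by (intro sum.cong refl) (auto simp: z_def field_simps)
    then show ?thesis using ff(3)[of v] v by (simp add: w_def B(2) n_def)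
  qed
  show thesis
  proof (rule that[of z])
    show "0 \<le> z u" for u using ff(1)[of u] by (simp add: z_def w_def)
    show "z (- u) = z u" for u
      using ff(2)[of u] dual.cube_minus[of u r] dual.cube_minus[of "- u" r]
      by (auto simp: z_def w_def U_def)
  next
    fix v assume v: "v \<in> L"
    have "2 * n * (infdist (v /\<^sub>R N) L)\<^sup>2 = (\<Sum>s\<in>cube r. (infdist (v /\<^sub>R N) L)\<^sup>2 + (infdist (- v /\<^sub>R N) L)\<^sup>2)"
      using infdist_uminus[of "v /\<^sub>R N"] by (simp add: n_def)
    also have "\<dots> \<le> (\<Sum>s\<in>cube r. K s (s + v) + K s (s + - v))"
      by (intro sum_mono add_mono K_ge)
    finally show "(infdist (v /\<^sub>R N) L)\<^sup>2 \<le> 2 * (\<Sum>u\<in>U. z u * (1 - cos (2 * pi * (u \<bullet> (v /\<^sub>R N)))))"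
      unfolding zw[OF v] using n by (simp add: field_simps)
    have "(\<Sum>s\<in>cube r. K s (s + v) + K s (s + - v)) \<le>
        (\<Sum>s\<in>cube r. (D * norm (v /\<^sub>R N))\<^sup>2 + (D * norm (- v /\<^sub>R N))\<^sup>2)"
      by (intro sum_mono add_mono K_le)
    also have "\<dots> = 2 * n * (D * norm (v /\<^sub>R N))\<^sup>2" by (simp add: n_def)
    finally show "2 * (\<Sum>u\<in>U. z u * (1 - cos (2 * pi * (u \<bullet> (v /\<^sub>R N))))) \<le> (D * norm (v /\<^sub>R N))\<^sup>2"
      unfolding zw[OF v] using n by (simp add: field_simps)
  qed (simp_all add: z_def)
qed

section \<open>The Hilbert space of square summable functions\<close>

definition square_summable :: "('a \<Rightarrow> complex) set" where
  "square_summable = {f. (\<lambda>u. (cmod (f u))\<^sup>2) summable_on UNIV}"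

definition ell2 :: "('a \<Rightarrow> complex) inner_space" where
  "ell2 = \<lparr>carrier = square_summable, monoid.mult = undefined, one = undefined,
     zero = (\<lambda>_. 0), add = (\<lambda>f g u. f u + g u), smult = (\<lambda>a f u. a * f u),
     cinner = (\<lambda>f g. \<Sum>\<^sub>\<infinity>u. cnj (f u) * g u)\<rparr>"

lemma ell2_simps [simp]:
  "carrier ell2 = square_summable" "\<zero>\<^bsub>ell2\<^esub> = (\<lambda>_. 0)"
  "f \<oplus>\<^bsub>ell2\<^esub> g = (\<lambda>u. f u + g u)" "a \<odot>\<^bsub>ell2\<^esub> f = (\<lambda>u. a * f u)"
  "cinner ell2 f g = (\<Sum>\<^sub>\<infinity>u. cnj (f u) * g u)"
  by (simp_all add: ell2_def)

lemma square_summableI: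
  assumes "\<And>F. finite F \<Longrightarrow> (\<Sum>u\<in>F. (cmod (f u))\<^sup>2) \<le> M"
  shows "f \<in> square_summable"
  unfolding square_summable_def
  by (intro CollectI nonneg_bdd_above_summable_on) (auto intro!: bdd_aboveI[of _ M] assms)

lemma square_summable_smult: "f \<in> square_summable \<Longrightarrow> (\<lambda>u. a * f u) \<in> square_summable"
  by (auto simp: square_summable_def norm_mult power_mult_distrib intro: summable_on_cmult_right)

lemma square_summable_add:
  assumes f: "f \<in> square_summable" and g: "g \<in> square_summable"
  shows "(\<lambda>u. f u + g u) \<in> square_summable"
proof -
  have "(\<lambda>u. 2 * (cmod (f u))\<^sup>2 + 2 * (cmod (g u))\<^sup>2) summable_on UNIV"
    using f g by (intro summable_on_add summable_on_cmult_right) (auto simp: square_summable_def)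
  moreover have "(cmod (f u + g u))\<^sup>2 \<le> 2 * (cmod (f u))\<^sup>2 + 2 * (cmod (g u))\<^sup>2" for u
  proof -
    have "(cmod (f u + g u))\<^sup>2 \<le> (cmod (f u) + cmod (g u))\<^sup>2"
      by (intro power_mono norm_triangle_ineq) simp
    then show ?thesis
      using sum_squares_bound[of "cmod (f u)" "cmod (g u)"] by (simp add: power2_sum)
  qed
  ultimately show ?thesis
    unfolding square_summable_def by (auto intro: summable_on_comparison_test)
qed

lemma summable_cinner:
  assumes f: "f \<in> square_summable" and g: "g \<in> square_summable"
  shows "(\<lambda>u. cnj (f u) * g u) summable_on UNIV"
proof (rule abs_summable_summable, rule summable_on_comparison_test)
  show "(\<lambda>u. (cmod (f u))\<^sup>2 + (cmod (g u))\<^sup>2) summable_on UNIV"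
    using f g by (intro summable_on_add) (auto simp: square_summable_def)
  show "cmod (cnj (f u) * g u) \<le> (cmod (f u))\<^sup>2 + (cmod (g u))\<^sup>2" for u
  proof -
    have "2 * (cmod (f u) * cmod (g u)) \<le> (cmod (f u))\<^sup>2 + (cmod (g u))\<^sup>2"
      using sum_squares_bound[of "cmod (f u)" "cmod (g u)"] by simp
    moreover have "0 \<le> cmod (f u) * cmod (g u)" by simp
    ultimately show ?thesis unfolding norm_mult complex_mod_cnj by linarith
  qed
qed auto

lemma cinner_ell2_self:
  assumes "f \<in> square_summable"
  shows "cinner ell2 f f = complex_of_real (\<Sum>\<^sub>\<infinity>u. (cmod (f u))\<^sup>2)"
proof -
  have "cnj (f u) * f u = complex_of_real ((cmod (f u))\<^sup>2)" for u
    by (simp only: complex_norm_square mult.commute)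
  moreover have "((\<lambda>u. (cmod (f u))\<^sup>2) has_sum (\<Sum>\<^sub>\<infinity>u. (cmod (f u))\<^sup>2)) UNIV"
    using assms by (intro has_sum_infsum) (simp add: square_summable_def)
  then have "(\<Sum>\<^sub>\<infinity>u. complex_of_real ((cmod (f u))\<^sup>2)) = complex_of_real (\<Sum>\<^sub>\<infinity>u. (cmod (f u))\<^sup>2)"
    by (intro infsumI has_sum_of_real)
  ultimately show ?thesis by (simp only: ell2_simps)
qed

lemma complex_inner_space_ell2: "complex_inner_space (ell2 :: ('a \<Rightarrow> complex) inner_space)"
proof (intro complex_inner_space.intro complex_inner_space_axioms.intro moduleI cring_complex_field)
  show "abelian_group (ell2 :: ('a \<Rightarrow> complex) inner_space)"
  proof (rule abelian_groupI)
    fix f :: "'a \<Rightarrow> complex" assume "f \<in> carrier ell2"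
    then show "\<exists>g\<in>carrier ell2. g \<oplus>\<^bsub>ell2\<^esub> f = \<zero>\<^bsub>ell2\<^esub>"
      using square_summable_smult[of f "-1"] by (intro bexI[of _ "\<lambda>u. - f u"]) auto
  qed (auto intro: square_summable_add simp: algebra_simps, simp add: square_summable_def)
next
  fix f g h :: "'a \<Rightarrow> complex"
  assume "f \<in> carrier ell2" "g \<in> carrier ell2" "h \<in> carrier ell2"
  then show "cinner ell2 f (g \<oplus>\<^bsub>ell2\<^esub> h) = cinner ell2 f g + cinner ell2 f h"
    using infsum_add[OF summable_cinner summable_cinner, of f g f h] by (simp add: distrib_left)
next
  fix f :: "'a \<Rightarrow> complex" assume f: "f \<in> carrier ell2" "f \<noteq> \<zero>\<^bsub>ell2\<^esub>"
  then obtain v where v: "f v \<noteq> 0" by auto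
  have "(cmod (f v))\<^sup>2 = (\<Sum>\<^sub>\<infinity>u\<in>{v}. (cmod (f u))\<^sup>2)" by simp
  also have "\<dots> \<le> (\<Sum>\<^sub>\<infinity>u. (cmod (f u))\<^sup>2)"
    using f by (intro infsum_mono2) (auto simp: square_summable_def)
  finally have "0 < (\<Sum>\<^sub>\<infinity>u. (cmod (f u))\<^sup>2)" using v by (auto intro: less_le_trans[rotated])
  then show "0 < cinner ell2 f f" using cinner_ell2_self[of f] f by (simp add: less_complex_def del: ell2_simps(5))
next
  fix f g :: "'a \<Rightarrow> complex" and a :: complex
  show "cinner ell2 f (a \<odot>\<^bsub>ell2\<^esub> g) = a * cinner ell2 f g"
    using infsum_cmult_right'[of a "\<lambda>u. cnj (f u) * g u" UNIV] by (simp add: mult_ac)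
  show "cinner ell2 g f = cnj (cinner ell2 f g)"
    by (simp add: infsum_cnj[symmetric] mult.commute)
qed (auto simp: square_summable_smult algebra_simps)

lemma hdist_ell2:
  assumes "f \<in> square_summable" "g \<in> square_summable"
  shows "hdist ell2 f g = sqrt (\<Sum>\<^sub>\<infinity>u. (cmod (f u - g u))\<^sup>2)"
proof -
  have "f \<ominus>\<^bsub>ell2\<^esub> g = (\<lambda>u. f u - g u)"
    using assms complex_inner_space.minus_eq_smult[OF complex_inner_space_ell2, of f g] by simp
  moreover have "(\<lambda>u. f u - g u) \<in> square_summable"
    using square_summable_add[OF assms(1) square_summable_smult[OF assms(2), of "-1"]] by simp
  ultimately show ?thesis
    by (simp add: hdist_def hnorm_def cinner_ell2_self del: ell2_simps(5))
qed

lemma hdist_ell2_nonneg: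
  "f \<in> square_summable \<Longrightarrow> g \<in> square_summable \<Longrightarrow> 0 \<le> hdist ell2 f g"
  by (simp add: hdist_ell2 infsum_nonneg)

lemma hdist_ell2_square:
  "f \<in> square_summable \<Longrightarrow> g \<in> square_summable \<Longrightarrow>
    (hdist ell2 f g)\<^sup>2 = (\<Sum>\<^sub>\<infinity>u. (cmod (f u - g u))\<^sup>2)"
  by (simp add: hdist_ell2 infsum_nonneg)

text \<open>
  A Cauchy sequence converges pointwise. Finite sums of \<open>(cmod (\<sigma> m u - \<sigma> n u))\<^sup>2\<close> are bounded by
  the squared distance, so letting \<open>n\<close> tend to infinity in them bounds all finite sums of the
  difference to the pointwise limit; this gives both membership of the limit and convergence.
\<close>

lemma complex_hilbert_space_ell2: "complex_hilbert_space (ell2 :: ('a \<Rightarrow> complex) inner_space)"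
proof (intro complex_hilbert_space.intro complex_inner_space_ell2
    complex_hilbert_space_axioms.intro)
  fix \<sigma> :: "nat \<Rightarrow> 'a \<Rightarrow> complex"
  assume "range \<sigma> \<subseteq> carrier ell2"
    and Cauchy: "\<forall>\<epsilon>>0. \<exists>N. \<forall>m\<ge>N. \<forall>n\<ge>N. hdist ell2 (\<sigma> m) (\<sigma> n) < \<epsilon>"
  then have \<sigma>: "\<sigma> n \<in> square_summable" for n by auto
  have fin: "(\<Sum>u\<in>F. (cmod (f u - g u))\<^sup>2) \<le> (hdist ell2 f g)\<^sup>2"
    if "finite F" "f \<in> square_summable" "g \<in> square_summable" for f g :: "'a \<Rightarrow> complex" and F
  proof -
    have "(\<lambda>u. f u - g u) \<in> square_summable"
      using square_summable_add[OF that(2) square_summable_smult[OF that(3), of "-1"]] by simp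
    then show ?thesis
      unfolding hdist_ell2_square[OF that(2,3)]
      by (intro finite_sum_le_infsum) (auto simp: square_summable_def that)
  qed
  have "Cauchy (\<lambda>n. \<sigma> n u)" for u
  proof (rule metric_CauchyI)
    fix \<epsilon> :: real assume "\<epsilon> > 0"
    then obtain N where N: "\<And>m n. m \<ge> N \<Longrightarrow> n \<ge> N \<Longrightarrow> hdist ell2 (\<sigma> m) (\<sigma> n) < \<epsilon>"
      using Cauchy by blast
    have "dist (\<sigma> m u) (\<sigma> n u) \<le> hdist ell2 (\<sigma> m) (\<sigma> n)" for m n
      by (rule power2_le_imp_le) (use fin[of "{u}", OF _ \<sigma> \<sigma>, of m n] hdist_ell2_nonneg[OF \<sigma> \<sigma>] in \<open>simp_all add: dist_norm\<close>)
    then show "\<exists>M. \<forall>m\<ge>M. \<forall>n\<ge>M. dist (\<sigma> m u) (\<sigma> n u) < \<epsilon>"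
      using N le_less_trans by blast
  qed
  then have "\<exists>l. (\<lambda>n. \<sigma> n u) \<longlonglongrightarrow> l" for u by (simp add: Cauchy_convergent_iff convergent_def)
  then obtain x where x: "\<And>u. (\<lambda>n. \<sigma> n u) \<longlonglongrightarrow> x u" by metis
  have tail: "(\<Sum>u\<in>F. (cmod (\<sigma> m u - x u))\<^sup>2) \<le> \<epsilon>\<^sup>2"
    if F: "finite F" and N: "\<And>n. n \<ge> N \<Longrightarrow> hdist ell2 (\<sigma> m) (\<sigma> n) < \<epsilon>" for F m N \<epsilon>
  proof (rule LIMSEQ_le_const2)
    show "(\<lambda>n. \<Sum>u\<in>F. (cmod (\<sigma> m u - \<sigma> n u))\<^sup>2) \<longlonglongrightarrow> (\<Sum>u\<in>F. (cmod (\<sigma> m u - x u))\<^sup>2)"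
      by (intro tendsto_intros x)
    have "(\<Sum>u\<in>F. (cmod (\<sigma> m u - \<sigma> n u))\<^sup>2) \<le> \<epsilon>\<^sup>2" if "n \<ge> N" for n
      using fin[OF F \<sigma> \<sigma>, of m n] power_mono[OF less_imp_le[OF N[OF that]] hdist_ell2_nonneg[OF \<sigma> \<sigma>], of 2] by linarith
    then show "\<exists>N. \<forall>n\<ge>N. (\<Sum>u\<in>F. (cmod (\<sigma> m u - \<sigma> n u))\<^sup>2) \<le> \<epsilon>\<^sup>2" by blast
  qed
  obtain N1 where N1: "\<And>m n. m \<ge> N1 \<Longrightarrow> n \<ge> N1 \<Longrightarrow> hdist ell2 (\<sigma> m) (\<sigma> n) < 1"
    using Cauchy zero_less_one by blast
  have "(\<lambda>u. \<sigma> N1 u - x u) \<in> square_summable"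
    by (rule square_summableI[of _ "1\<^sup>2"]) (use tail[of _ N1 N1 1] N1 in auto)
  then have "(\<lambda>u. \<sigma> N1 u + (-1) * (\<sigma> N1 u - x u)) \<in> square_summable"
    by (intro square_summable_add square_summable_smult \<sigma>)
  then have xs: "x \<in> square_summable" by simp
  have "(\<lambda>n. hdist ell2 (\<sigma> n) x) \<longlonglongrightarrow> 0"
  proof (rule LIMSEQ_I)
    fix \<epsilon> :: real assume \<epsilon>: "\<epsilon> > 0"
    then have "\<exists>N. \<forall>m\<ge>N. \<forall>n\<ge>N. hdist ell2 (\<sigma> m) (\<sigma> n) < \<epsilon> / 2"
      using Cauchy[rule_format, of "\<epsilon> / 2"] by simp
    then obtain N where N: "\<And>m n. m \<ge> N \<Longrightarrow> n \<ge> N \<Longrightarrow> hdist ell2 (\<sigma> m) (\<sigma> n) < \<epsilon> / 2"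
      by blast
    have "hdist ell2 (\<sigma> m) x \<le> \<epsilon> / 2" if "m \<ge> N" for m
    proof (rule power2_le_imp_le)
      show "(hdist ell2 (\<sigma> m) x)\<^sup>2 \<le> (\<epsilon> / 2)\<^sup>2"
        unfolding hdist_ell2_square[OF \<sigma> xs]
        by (rule infsum_le_finite_sums)
          (use tail[of _ N m "\<epsilon> / 2"] N that square_summable_add[OF \<sigma> square_summable_smult[OF xs], of m "-1"]
            in \<open>auto simp: square_summable_def\<close>)
    qed (use \<epsilon> in simp)
    then show "\<exists>N. \<forall>n\<ge>N. norm (hdist ell2 (\<sigma> n) x - 0) < \<epsilon>"
      using hdist_ell2_nonneg[OF \<sigma> xs] \<epsilon> by (intro exI[of _ N]) force
  qed
  then show "\<exists>x\<in>carrier ell2. (\<lambda>n. hdist ell2 (\<sigma> n) x) \<longlonglongrightarrow> 0" using xs by auto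
qed

section \<open>Quadratic bounds for the cosine\<close>

lemma one_minus_cos_le: "1 - cos t \<le> t\<^sup>2 / 2" for t :: real
proof -
  have "(sin (t / 2))\<^sup>2 \<le> (t / 2)\<^sup>2"
    using abs_sin_x_le_abs_x[of "t / 2"] by (rule abs_le_square_iff[THEN iffD1])
  then show ?thesis
    using cos_double_sin[of "t / 2"] by (simp add: power_divide)
qed

text \<open>
  Some quadratic lower bound on a full period is all that is needed; the constant \<open>2\<close> is what
  \<open>\<bar>sin y - y\<bar> \<le> \<bar>y\<bar>\<^sup>3 / 6\<close> and \<open>3 < \<pi> < 4\<close> give.
\<close>

lemma one_minus_cos_ge:
  assumes "\<bar>s\<bar> \<le> 1 / 2"
  shows "2 * s\<^sup>2 \<le> 1 - cos (2 * pi * s)"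
proof -
  define y where "y = pi * s"
  have y: "\<bar>y\<bar> \<le> 2"
    using mult_mono[of pi 4 "\<bar>s\<bar>" "1 / 2"] assms pi_less_4 by (simp add: y_def abs_mult)
  have "\<bar>sin y - y\<bar> \<le> \<bar>y\<bar> ^ 3 / 6"
    using Maclaurin_sin_bound[of y 3] by (simp add: numeral_3_eq_3 sin_coeff_def fact_numeral)
  also have "\<dots> = \<bar>y\<bar> * \<bar>y\<bar>\<^sup>2 / 6" by (simp add: power3_eq_cube power2_eq_square)
  also have "\<dots> \<le> \<bar>y\<bar> * 2\<^sup>2 / 6"
    using y by (intro divide_right_mono mult_left_mono power_mono) auto
  finally have "\<bar>sin y - y\<bar> \<le> 2 * \<bar>y\<bar> / 3" by simp
  then have "\<bar>y\<bar> / 3 \<le> \<bar>sin y\<bar>" by linarith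
  then have "(\<bar>y\<bar> / 3)\<^sup>2 \<le> \<bar>sin y\<bar>\<^sup>2" by (intro power_mono) auto
  moreover have "\<bar>s\<bar> \<le> \<bar>y\<bar> / 3"
    using mult_right_mono[of 3 pi "\<bar>s\<bar>"] pi_gt3 by (simp add: y_def abs_mult)
  then have "\<bar>s\<bar>\<^sup>2 \<le> (\<bar>y\<bar> / 3)\<^sup>2" by (intro power_mono) auto
  moreover have "1 - cos (2 * pi * s) = 2 * (sin y)\<^sup>2"
    using cos_double_sin[of y] by (simp add: y_def mult.assoc)
  ultimately show ?thesis by simp
qed

section \<open>The semidefinite constraint as a quadratic inequality\<close>

lemma infsum_finite_support:
  fixes f :: "'a \<Rightarrow> 'b::{comm_monoid_add, t2_space}"
  assumes "finite S" "S \<subseteq> A" "\<And>u. u \<in> A - S \<Longrightarrow> f u = 0"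
  shows "f summable_on A" "infsum f A = sum f S"
proof -
  have "(f has_sum sum f S) A" by (rule has_sum_finite_neutralI) (use assms in auto)
  then show "f summable_on A" "infsum f A = sum f S"
    by (auto simp: summable_on_def infsumI)
qed

lemma inner_outer_square: "x \<bullet> (outer_square u *v x) = (u \<bullet> x)\<^sup>2"
proof -
  have "outer_square u *v x = (u \<bullet> x) *\<^sub>R u"
    by (simp add: outer_square_def matrix_vector_mult_def vec_eq_iff inner_vec_def
        sum_distrib_left mult_ac)
  then show ?thesis by (simp add: power2_eq_square inner_commute)
qed

lemma norm_outer_square: "norm (outer_square u) = (norm u)\<^sup>2"
proof -
  have "outer_square u $ i = u $ i *\<^sub>R u" for i
    by (simp add: outer_square_def vec_eq_iff)
  then show ?thesis
    by (simp add: norm_vec_def[of "outer_square u"] L2_set_def power_mult_distrib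
        sum_distrib_right[symmetric] real_sqrt_mult)
      (simp add: norm_vec_def L2_set_def power2_eq_square)
qed

text \<open>
  The series of matrices converges in a finite-dimensional space, so the quadratic form and the
  entries, being linear in the matrix, may be applied term by term.
\<close>

lemma psd_outer_series:
  fixes w :: "real^'n \<Rightarrow> real"
  assumes S: "(\<lambda>u. w u *\<^sub>R outer_square u) summable_on A"
  shows "(\<lambda>u. w u * (u \<bullet> x)\<^sup>2) summable_on A"
    and "psd (C *\<^sub>R mat 1 - c *\<^sub>R (\<Sum>\<^sub>\<infinity>u\<in>A. w u *\<^sub>R outer_square u)) \<longleftrightarrow>
      (\<forall>x. c * (\<Sum>\<^sub>\<infinity>u\<in>A. w u * (u \<bullet> x)\<^sup>2) \<le> C * (norm x)\<^sup>2)"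
proof -
  let ?M = "\<Sum>\<^sub>\<infinity>u\<in>A. w u *\<^sub>R outer_square u"
  have lin: "bounded_linear (\<lambda>M :: real^'n^'n. x \<bullet> (M *v x))" for x
    by (rule linear_conv_bounded_linear[THEN iffD1], rule linearI)
      (simp_all add: matrix_vector_mult_add_rdistrib inner_add_right scaleR_matrix_vector_assoc[symmetric])
  have *: "((\<lambda>u. w u * (u \<bullet> x)\<^sup>2) has_sum x \<bullet> (?M *v x)) A" for x
    using has_sum_bounded_linear[OF lin has_sum_infsum[OF S], of x]
    by (simp add: inner_outer_square scaleR_matrix_vector_assoc[symmetric])
  then show "(\<lambda>u. w u * (u \<bullet> x)\<^sup>2) summable_on A" by (auto simp: summable_on_def)
  have q: "x \<bullet> (?M *v x) = (\<Sum>\<^sub>\<infinity>u\<in>A. w u * (u \<bullet> x)\<^sup>2)" for x using *[of x] by (simp add: infsumI)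
  have entry: "?M $ i $ j = (\<Sum>\<^sub>\<infinity>u\<in>A. w u * (u $ i * u $ j))" for i j
  proof -
    have "bounded_linear (\<lambda>M :: real^'n^'n. M $ i $ j)"
      by (intro bounded_linear_compose[OF bounded_linear_vec_nth bounded_linear_vec_nth])
    from infsumI[OF has_sum_bounded_linear[OF this has_sum_infsum[OF S]]] show ?thesis
      by (simp add: outer_square_def)
  qed
  have "transpose (C *\<^sub>R mat 1 - c *\<^sub>R ?M) = C *\<^sub>R mat 1 - c *\<^sub>R ?M"
    unfolding vec_eq_iff transpose_def by (simp add: entry mat_def mult.commute)
  moreover have "x \<bullet> ((C *\<^sub>R mat 1 - c *\<^sub>R ?M) *v x) = C * (norm x)\<^sup>2 - c * (x \<bullet> (?M *v x))" for x
    by (simp add: matrix_vector_mult_diff_rdistrib inner_diff_right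
        scaleR_matrix_vector_assoc[symmetric] power2_norm_eq_inner)
  ultimately show "psd (C *\<^sub>R mat 1 - c *\<^sub>R ?M) \<longleftrightarrow>
      (\<forall>x. c * (\<Sum>\<^sub>\<infinity>u\<in>A. w u * (u \<bullet> x)\<^sup>2) \<le> C * (norm x)\<^sup>2)"
    by (simp add: psd_def q)
qed

text \<open>
  For nonnegative \<open>w\<close>, this is the squared norm of the difference of the images of \<open>x\<close> and \<open>0\<close>
  under the map with components \<open>sqrt (w u) * exp (2 * \<pi> * \<i> * (u \<bullet> x))\<close>.
\<close>

definition char_energy :: "(real^'n) set \<Rightarrow> (real^'n \<Rightarrow> real) \<Rightarrow> real^'n \<Rightarrow> real" where
  "char_energy A w x = 2 * (\<Sum>\<^sub>\<infinity>u\<in>A. w u * (1 - cos (2 * pi * (u \<bullet> x))))"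

lemma summable_char_energy:
  assumes "w summable_on A" "\<And>u. u \<in> A \<Longrightarrow> 0 \<le> w u"
  shows "(\<lambda>u. w u * (1 - cos (2 * pi * (u \<bullet> x)))) summable_on A"
proof (rule summable_on_comparison_test)
  show "(\<lambda>u. w u * 2) summable_on A" by (intro summable_on_cmult_left assms)
  fix u assume u: "u \<in> A"
  have "1 - cos (2 * pi * (u \<bullet> x)) \<le> 2" using cos_ge_minus_one[of "2 * pi * (u \<bullet> x)"] by linarith
  then show "w u * (1 - cos (2 * pi * (u \<bullet> x))) \<le> w u * 2"
    using assms(2)[OF u] by (rule mult_left_mono)
  show "0 \<le> w u * (1 - cos (2 * pi * (u \<bullet> x)))" using assms(2)[OF u] by simp
qed

lemma feasible_iff:
  "feasible L C z \<longleftrightarrow>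
     0 \<le> C \<and> z \<in> ell1 (dual_lattice L) \<and>
     (\<forall>u\<in>dual_lattice L. z u = z (- u) \<and> 0 \<le> z u) \<and>
     (\<forall>x\<in>voronoi_cell L. (norm x)\<^sup>2 \<le> char_energy (dual_lattice L) (\<lambda>u. Re (z u)) x) \<and>
     (\<lambda>u. Re (z u) *\<^sub>R outer_square u) summable_on dual_lattice L \<and>
     (\<forall>x. 4 * pi\<^sup>2 * (\<Sum>\<^sub>\<infinity>u\<in>dual_lattice L. Re (z u) * (u \<bullet> x)\<^sup>2) \<le> C * (norm x)\<^sup>2)"
  unfolding feasible_def char_energy_def 
  using psd_outer_series(2)[of "\<lambda>u. Re (z u)" "dual_lattice L" C "4 * pi\<^sup>2"] by blast

section \<open>Feasible weights give embeddings\<close>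

text \<open>
  The energy of the weights is periodic, so its bounds on the Voronoi cell extend to all
  vectors, with the distance to \<open>L\<close> in place of the norm. Mapping \<open>x\<close> to the weighted
  exponentials then gives an embedding that expands distances by a factor between \<open>1\<close> and
  \<open>sqrt C\<close>.
\<close>

lemma feasible_imp_c2_le:
  fixes L :: "(real^'n) set"
  assumes "is_lattice L" and feas: "feasible L C z"
  shows "(c2 L)\<^sup>2 \<le> ennreal C"
proof -
  obtain B d where B: "dual_bases B (\<lambda>b. b) d" "L = dual_bases.lat B d"
    using lattice_dual_bases[OF assms(1)] by metis
  interpret closed_subgroup L by (rule closed_subgroup_lat[OF B])
  define \<Lambda> where "\<Lambda> = dual_lattice L"
  define w where "w u = Re (z u)" for u
  define E where "E = char_energy \<Lambda> w"
  note feas = feas[unfolded feasible_iff, folded \<Lambda>_def w_def, folded E_def]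
  have C: "0 \<le> C" using feas by blast
  have w: "0 \<le> w u" "cmod (z u) = w u" if "u \<in> \<Lambda>" for u
    using feas that by (auto simp: w_def less_eq_complex_def cmod_eq_Re)
  have sw: "w summable_on \<Lambda>"
    using feas summable_on_cong[of \<Lambda> "\<lambda>u. cmod (z u)" w] w by (auto simp: ell1_def)
  have E_period: "E (x - v) = E x" if v: "v \<in> L" for x v
  proof -
    have "cos (2 * pi * (u \<bullet> (x - v))) = cos (2 * pi * (u \<bullet> x))" if u: "u \<in> \<Lambda>" for u
    proof -
      have "u \<bullet> v \<in> \<int>" using u v by (auto simp: \<Lambda>_def dual_lattice_def)
      then obtain m :: int where "u \<bullet> v = of_int m" by (rule Ints_cases)
      then show ?thesis
        using cos_int_2pin[of m] sin_int_2pin[of m]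
        by (simp add: inner_diff_right right_diff_distrib cos_diff)
    qed
    then show ?thesis
      by (auto simp: E_def char_energy_def intro!: arg_cong[where f = "(*) 2"] infsum_cong)
  qed
  have E: "(infdist x L)\<^sup>2 \<le> E x \<and> E x \<le> C * (infdist x L)\<^sup>2" for x
  proof -
    obtain v where v: "v \<in> L" "x - v \<in> voronoi_cell L" "infdist x L = norm (x - v)"
      by (rule voronoi_reduce)
    have "E (x - v) \<le> 2 * (\<Sum>\<^sub>\<infinity>u\<in>\<Lambda>. 2 * pi\<^sup>2 * (w u * (u \<bullet> (x - v))\<^sup>2))"
      unfolding E_def char_energy_def
    proof (intro mult_left_mono infsum_mono summable_char_energy summable_on_cmult_right
        psd_outer_series(1) sw w)
      show "(\<lambda>u. w u *\<^sub>R outer_square u) summable_on \<Lambda>" using feas by blast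
      fix u assume "u \<in> \<Lambda>"
      then have "w u * (1 - cos (2 * pi * (u \<bullet> (x - v)))) \<le> w u * ((2 * pi * (u \<bullet> (x - v)))\<^sup>2 / 2)"
        by (intro mult_left_mono one_minus_cos_le w)
      then show "w u * (1 - cos (2 * pi * (u \<bullet> (x - v)))) \<le> 2 * pi\<^sup>2 * (w u * (u \<bullet> (x - v))\<^sup>2)"
        by (simp add: power_mult_distrib mult_ac)
    qed simp_all
    also have "\<dots> = 4 * pi\<^sup>2 * (\<Sum>\<^sub>\<infinity>u\<in>\<Lambda>. w u * (u \<bullet> (x - v))\<^sup>2)"
      unfolding infsum_cmult_right' by simp
    also have "\<dots> \<le> C * (norm (x - v))\<^sup>2" using feas by blast
    finally have "E x \<le> C * (infdist x L)\<^sup>2" using v E_period by simp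
    moreover have "(norm (x - v))\<^sup>2 \<le> E (x - v)" using feas v by blast
    ultimately show ?thesis using v E_period by simp
  qed
  define \<psi> where "\<psi> x u = (if u \<in> \<Lambda> then of_real (sqrt (w u)) * cis (2 * pi * (u \<bullet> x)) else 0)"
    for x u :: "real^'n"
  have \<psi>: "\<psi> x \<in> square_summable" for x
    unfolding square_summable_def mem_Collect_eq
    by (rule summable_on_cong_neutral[THEN iffD1, OF _ _ _ sw])
      (auto simp: \<psi>_def norm_mult w)
  have "(cmod (\<psi> x u - \<psi> y u))\<^sup>2 = 2 * (w u * (1 - cos (2 * pi * (u \<bullet> (x - y)))))" if "u \<in> \<Lambda>" for x y u
  proof -
    have cis: "(cmod (cis a - cis b))\<^sup>2 = 2 * (1 - cos (a - b))" for a b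
      using sin_cos_squared_add[of a] sin_cos_squared_add[of b]
      by (simp add: cmod_power2 power2_diff cos_diff algebra_simps)
    have diff: "\<psi> x u - \<psi> y u = of_real (sqrt (w u)) * (cis (2 * pi * (u \<bullet> x)) - cis (2 * pi * (u \<bullet> y)))"
      using that by (simp add: \<psi>_def right_diff_distrib)
    show ?thesis
      unfolding diff norm_mult power_mult_distrib cis
      using w(1)[OF that] by (simp add: inner_diff_right right_diff_distrib)
  qed
  then have "(hdist ell2 (\<psi> x) (\<psi> y))\<^sup>2 = (\<Sum>\<^sub>\<infinity>u\<in>\<Lambda>. 2 * (w u * (1 - cos (2 * pi * (u \<bullet> (x - y))))))" for x y
    unfolding hdist_ell2_square[OF \<psi> \<psi>]
    by (intro infsum_cong_neutral) (auto simp: \<psi>_def)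
  then have \<psi>E: "(hdist ell2 (\<psi> x) (\<psi> y))\<^sup>2 = E (x - y)" for x y
    by (simp add: E_def char_energy_def infsum_cmult_right')
  define h where "h x y = hdist ell2 (\<psi> x) (\<psi> y)" for x y
  have h0: "0 \<le> h x y" for x y using hdist_ell2_nonneg[OF \<psi> \<psi>] by (simp add: h_def)
  have lower: "infdist (x - y) L \<le> h x y" for x y
    by (rule power2_le_imp_le) (use E[of "x - y"] \<psi>E[of x y] h0 in \<open>auto simp: h_def\<close>)
  have upper: "h x y \<le> sqrt C * infdist (x - y) L" for x y
    by (rule power2_le_imp_le)
      (use E[of "x - y"] \<psi>E[of x y] C in \<open>auto simp: h_def power_mult_distrib infdist_nonneg\<close>)
  define rep where "rep X = (SOME x. X = torus_point L x)" for X
  have rep: "torus_point L (rep X) = X" if "X \<in> torus L" for X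
    using that someI_ex[of "\<lambda>x. X = torus_point L x"] by (auto simp: torus_eq_range rep_def)
  define \<phi> where "\<phi> X = \<psi> (rep X)" for X
  have td: "torus_dist L X Y = infdist (rep X - rep Y) L" if "X \<in> torus L" "Y \<in> torus L" for X Y
    using torus_dist_point[of "rep X" "rep Y"] rep that by simp
  have "X = Y" if XY: "X \<in> torus L" "Y \<in> torus L" and eq: "\<phi> X = \<phi> Y" for X Y
  proof -
    have "h (rep X) (rep Y) = 0" using eq by (simp add: h_def \<phi>_def hdist_ell2[OF \<psi> \<psi>])
    then have "infdist (rep X - rep Y) L = 0"
      using lower[of "rep X" "rep Y"] infdist_nonneg[of "rep X - rep Y" L] by simp
    then have "rep X - rep Y \<in> L"
      using in_closed_iff_infdist_zero[OF closed, of "rep X - rep Y"] zero by blast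
    then show ?thesis using torus_point_eq_iff rep XY by metis
  qed
  then have "euclidean_embedding L ell2 \<phi>"
    by (auto simp: euclidean_embedding_def complex_hilbert_space_ell2 \<phi>_def \<psi> inj_on_def)
  then have "c2 L \<le> distortion L ell2 \<phi>" by (rule c2_le_distortion)
  also have "\<dots> \<le> ennreal (sqrt C) * ennreal 1"
    unfolding distortion_def
  proof (intro mult_mono SUP_least)
    fix p assume p: "p \<in> {(X, Y). X \<in> torus L \<and> Y \<in> torus L \<and> X \<noteq> Y}"
    obtain X Y where XY: "p = (X, Y)" by (cases p)
    have "h (rep X) (rep Y) / infdist (rep X - rep Y) L \<le> sqrt C"
      using upper[of "rep X" "rep Y"] infdist_nonneg[of "rep X - rep Y" L] C
      by (cases "infdist (rep X - rep Y) L = 0") (auto simp: pos_divide_le_eq less_le)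
    moreover have "infdist (rep X - rep Y) L / h (rep X) (rep Y) \<le> 1"
      using lower[of "rep X" "rep Y"] h0[of "rep X" "rep Y"]
      by (cases "h (rep X) (rep Y) = 0") (auto simp: pos_divide_le_eq less_le)
    ultimately show
      "(case p of (X, Y) \<Rightarrow> ennreal (hdist ell2 (\<phi> X) (\<phi> Y) / torus_dist L X Y)) \<le> ennreal (sqrt C)"
      "(case p of (X, Y) \<Rightarrow> ennreal (torus_dist L X Y / hdist ell2 (\<phi> X) (\<phi> Y))) \<le> ennreal 1"
      using p C unfolding XY by (auto simp: td h_def \<phi>_def intro!: ennreal_leI simp del: ennreal_1)
  qed auto
  finally have "c2 L \<le> ennreal (sqrt C)" by simp
  then have "(c2 L)\<^sup>2 \<le> (ennreal (sqrt C))\<^sup>2" by (rule power_mono) simp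
  also have "\<dots> = ennreal C" using C by (simp add: ennreal_power)
  finally show ?thesis .
qed

text \<open>
  A constant weight on the dual basis vectors and their negatives is feasible for some \<open>C\<close>: a
  vector of the Voronoi cell is no longer than its reduction with coordinates in
  \<open>[- 1 / 2, 1 / 2]\<close>, whose squared norm is bounded by a multiple of the sum of the squared
  coordinates and thus of the energy. With \<open>feasible_imp_c2_le\<close> this shows that \<open>c2 L\<close> is finite.
\<close>

lemma feasible_exists:
  fixes L :: "(real^'n) set"
  assumes "is_lattice L"
  shows "\<exists>C z. feasible L C z"
proof -
  obtain B d where B: "dual_bases B (\<lambda>b. b) d" "L = dual_bases.lat B d"
    and dual: "dual_lattice L = dual_bases.lat B (\<lambda>b. b)"
    using lattice_dual_bases[OF assms] by metis
  interpret dual_bases B "\<lambda>b. b" d by (rule B)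
  interpret dual: dual_bases B d "\<lambda>b. b" by (rule swap)
  interpret closed_subgroup L by (rule closed_subgroup_lat[OF B])
  define S where "S = d ` B \<union> uminus ` d ` B"
  define M where "M = (\<Sum>b\<in>B. (norm b)\<^sup>2)"
  define w where "w u = (if u \<in> S then M else 0)" for u
  define C where "C = 4 * pi\<^sup>2 * (\<Sum>u\<in>S. M * (norm u)\<^sup>2)"
  have M: "0 \<le> M" by (simp add: M_def sum_nonneg)
  have "finite S" using finite_index by (simp add: S_def)
  moreover have "d b \<in> dual_lattice L" "- d b \<in> dual_lattice L" if "b \<in> B" for b
    using dual.basis_in_lat[OF that] dual.lat_minus by (simp_all add: dual)
  then have "S \<subseteq> dual_lattice L" by (auto simp: S_def)
  ultimately have S: "finite S" "S \<subseteq> dual_lattice L" .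
  have "- u \<in> S" if "u \<in> S" for u using that by (auto simp: S_def)
  then have S_minus: "- u \<in> S \<longleftrightarrow> u \<in> S" for u by (metis minus_minus)
  have supp: "f summable_on dual_lattice L" "infsum f (dual_lattice L) = sum f S"
    if "\<And>u. u \<notin> S \<Longrightarrow> f u = 0" for f :: "real^'n \<Rightarrow> 'b::{comm_monoid_add, t2_space}"
    using infsum_finite_support[OF S, of f] that by auto
  have inj: "inj_on d B"
  proof (rule inj_onI)
    fix a b assume "a \<in> B" "b \<in> B" "d a = d b"
    then show "a = b" using biorthogonal[of a b] biorthogonal[of b b] by (auto split: if_splits)
  qed
  have w: "0 \<le> w u" "w (- u) = w u" "u \<notin> S \<Longrightarrow> w u = 0" for u
    using M by (simp_all add: w_def S_minus)
  have "(norm x)\<^sup>2 \<le> char_energy (dual_lattice L) w x" if x: "x \<in> voronoi_cell L" for x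
  proof -
    \<comment> \<open>The coordinates of \<open>x\<close> after subtracting the lattice vector \<open>v\<close> with the rounded coordinates.\<close>
    define s where "s b = d b \<bullet> x - of_int (round (d b \<bullet> x))" for b
    define v where "v = (\<Sum>b\<in>B. of_int (round (d b \<bullet> x)) *\<^sub>R b)"
    have v: "v \<in> L" unfolding B(2) lat_def v_def by (simp add: coord_comb)
    have s: "d b \<bullet> (x - v) = s b" if "b \<in> B" for b
      using that by (simp add: inner_diff_right v_def coord_comb s_def)
    have cos: "2 * (s b)\<^sup>2 \<le> 1 - cos (2 * pi * (d b \<bullet> x))" for b
    proof -
      have "\<bar>s b\<bar> \<le> 1 / 2"
        using of_int_round_abs_le[of "d b \<bullet> x"] by (simp add: s_def abs_minus_commute)
      moreover have "cos (2 * pi * s b) = cos (2 * pi * (d b \<bullet> x))"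
        using cos_int_2pin[of "round (d b \<bullet> x)"] sin_int_2pin[of "round (d b \<bullet> x)"]
        by (simp add: s_def right_diff_distrib cos_diff)
      ultimately show ?thesis using one_minus_cos_ge[of "s b"] by simp
    qed
    have "(norm x)\<^sup>2 \<le> (norm (x - v))\<^sup>2"
      using x v by (intro power_mono) (auto simp: voronoi_cell_def)
    also have "\<dots> \<le> M * (\<Sum>b\<in>B. (s b)\<^sup>2)"
      using norm_le_coords[of "x - v"] by (simp add: M_def s)
    also have "\<dots> \<le> M * (\<Sum>b\<in>B. 2 * (1 - cos (2 * pi * (d b \<bullet> x))))"
      using cos M by (intro mult_left_mono sum_mono) (smt (verit) zero_le_power2)+
    also have "\<dots> = 2 * (\<Sum>b\<in>B. M * (1 - cos (2 * pi * (d b \<bullet> x))))"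
      by (simp add: sum_distrib_left mult_ac)
    also have "\<dots> = 2 * (\<Sum>u\<in>d ` B. M * (1 - cos (2 * pi * (u \<bullet> x))))"
      by (simp add: sum.reindex[OF inj])
    also have "\<dots> \<le> 2 * (\<Sum>u\<in>S. w u * (1 - cos (2 * pi * (u \<bullet> x))))"
    proof -
      have "(\<Sum>u\<in>d ` B. w u * (1 - cos (2 * pi * (u \<bullet> x)))) \<le> (\<Sum>u\<in>S. w u * (1 - cos (2 * pi * (u \<bullet> x))))"
        using S M by (intro sum_mono2) (auto simp: S_def w_def)
      then show ?thesis by (simp add: w_def S_def)
    qed
    also have "\<dots> = char_energy (dual_lattice L) w x"
      by (simp add: char_energy_def supp w_def)
    finally show ?thesis .
  qed
  moreover have "4 * pi\<^sup>2 * (\<Sum>\<^sub>\<infinity>u\<in>dual_lattice L. w u * (u \<bullet> x)\<^sup>2) \<le> C * (norm x)\<^sup>2" for x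
  proof -
    have "(\<Sum>u\<in>S. w u * (u \<bullet> x)\<^sup>2) \<le> (\<Sum>u\<in>S. M * (norm u)\<^sup>2 * (norm x)\<^sup>2)"
    proof (rule sum_mono)
      fix u assume "u \<in> S"
      have "(u \<bullet> x)\<^sup>2 \<le> (norm u)\<^sup>2 * (norm x)\<^sup>2"
        using Cauchy_Schwarz_ineq[of u x] by (simp add: power2_norm_eq_inner)
      then have "M * (u \<bullet> x)\<^sup>2 \<le> M * ((norm u)\<^sup>2 * (norm x)\<^sup>2)" using M by (rule mult_left_mono)
      then show "w u * (u \<bullet> x)\<^sup>2 \<le> M * (norm u)\<^sup>2 * (norm x)\<^sup>2"
        using \<open>u \<in> S\<close> by (simp add: w_def mult.assoc)
    qed
    then have "4 * pi\<^sup>2 * (\<Sum>u\<in>S. w u * (u \<bullet> x)\<^sup>2) \<le> 4 * pi\<^sup>2 * (\<Sum>u\<in>S. M * (norm u)\<^sup>2 * (norm x)\<^sup>2)"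
      by (rule mult_left_mono) simp
    then show ?thesis
      by (simp add: supp w_def C_def sum_distrib_right mult.assoc)
  qed
  moreover have "0 \<le> C" using M by (simp add: C_def sum_nonneg)
  ultimately have "feasible L C (\<lambda>u. of_real (w u))"
    unfolding feasible_iff using w by (auto simp: ell1_def supp less_eq_complex_def)
  then show ?thesis by blast
qed

section \<open>Limits of weights\<close>

lemma compact_bounded_functions: "compact {f :: 'a \<Rightarrow> real. \<forall>u. f u \<in> {0..M}}"
proof -
  have "compactin (product_topology (\<lambda>_ :: 'a. euclidean :: real topology) UNIV) (PiE UNIV (\<lambda>_. {0..M}))"
    by (simp add: compactin_PiE)
  then show ?thesis
    by (simp add: euclidean_product_topology PiE_def Pi_def)
qed

text \<open>
  Tychonoff's theorem for a sequence in a product of intervals. A filter below \<open>sequentially\<close>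
  takes the place of a subsequence, so the index type may be uncountable.
\<close>

lemma bounded_functions_cluster:
  fixes z :: "nat \<Rightarrow> 'a \<Rightarrow> real"
  assumes "\<And>k u. z k u \<in> {0..M}"
  obtains \<zeta> G where "G \<noteq> bot" "G \<le> sequentially" "\<And>u. ((\<lambda>k. z k u) \<longlongrightarrow> \<zeta> u) G"
proof -
  have "\<exists>\<zeta>. inf (nhds \<zeta>) (filtermap z sequentially) \<noteq> bot"
    using compact_bounded_functions[of M, unfolded compact_filter, rule_format,
        of "filtermap z sequentially"] assms
    by (auto simp: filtermap_bot_iff eventually_filtermap)
  then obtain \<zeta> where \<zeta>: "inf (nhds \<zeta>) (filtermap z sequentially) \<noteq> bot" by blast
  define G where "G = inf (filtercomap z (nhds \<zeta>)) sequentially"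
  have "G \<noteq> bot"
  proof
    assume "G = bot"
    then have "eventually (\<lambda>_. False) G" by simp
    then obtain P Q where P: "eventually P (filtercomap z (nhds \<zeta>))"
      and Q: "eventually Q sequentially" and PQ: "\<And>k. P k \<Longrightarrow> Q k \<Longrightarrow> False"
      unfolding G_def eventually_inf by blast
    from P obtain P' where P': "eventually P' (nhds \<zeta>)" "\<And>k. P' (z k) \<Longrightarrow> P k"
      unfolding eventually_filtercomap by blast
    have "eventually (\<lambda>f. \<not> P' f) (filtermap z sequentially)"
      unfolding eventually_filtermap using Q by (rule eventually_mono) (use P' PQ in blast)
    then have "eventually (\<lambda>_. False) (inf (nhds \<zeta>) (filtermap z sequentially))"
      unfolding eventually_inf using P'(1) by blast
    then show False using \<zeta> by (simp add: eventually_False)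
  qed
  moreover have "G \<le> sequentially" by (simp add: G_def)
  moreover have "((\<lambda>k. z k u) \<longlongrightarrow> \<zeta> u) G" for u
  proof -
    have "filterlim (\<lambda>f. f u) (nhds (\<zeta> u)) (nhds \<zeta>)"
    proof (rule topological_tendstoI)
      fix V :: "real set" assume "open V" "\<zeta> u \<in> V"
      then show "eventually (\<lambda>f. f u \<in> V) (nhds \<zeta>)"
        unfolding eventually_nhds
        by (intro exI[of _ "(\<lambda>f. f u) -` V"])
          (auto intro: open_vimage continuous_on_product_coordinates)
    qed
    moreover have "filterlim z (nhds \<zeta>) G"
      unfolding G_def by (rule filterlim_mono[OF filterlim_filtercomap order_refl inf_le1])
    ultimately show ?thesis by (rule filterlim_compose)
  qed
  ultimately show thesis by (rule that)
qed

text \<open>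
  At small multiples of \<open>x\<close>, the energy recovers the quadratic form of the semidefinite
  constraint.
\<close>

lemma second_difference_cos:
  "((\<lambda>h. 2 * (1 - cos (2 * pi * (a * h))) / h\<^sup>2) \<longlongrightarrow> 4 * pi\<^sup>2 * a\<^sup>2) (at 0)" for a :: real
proof -
  have "((\<lambda>h. sin (pi * a * h)) has_real_derivative pi * a) (at 0)"
    by (auto intro!: derivative_eq_intros)
  then have "((\<lambda>h. sin (pi * a * h) / h) \<longlongrightarrow> pi * a) (at 0)"
    by (simp add: DERIV_def)
  then have "((\<lambda>h. 4 * (sin (pi * a * h) / h)\<^sup>2) \<longlongrightarrow> 4 * (pi * a)\<^sup>2) (at 0)"
    by (intro tendsto_intros)
  moreover have "4 * (sin (pi * a * h) / h)\<^sup>2 = 2 * (1 - cos (2 * pi * (a * h))) / h\<^sup>2" for h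
    using cos_double_sin[of "pi * a * h"] by (simp add: power_divide mult_ac)
  moreover have "4 * (pi * a)\<^sup>2 = 4 * pi\<^sup>2 * a\<^sup>2"
    by (simp add: power_mult_distrib)
  ultimately show ?thesis by (simp only:)
qed

text \<open>
  The function \<open>q u = (\<Sum>i\<in>I. (u \<bullet> e i)\<^sup>2)\<close> is comparable to the squared norm, and it is at least
  \<open>1\<close> on nonzero dual vectors, as these have integral inner products with the basis. The upper
  bound at the points \<open>e i /\<^sub>R N k\<close> gives a bound \<open>M\<close> for \<open>\<Sum>u. z k u * q u\<close> independent of
  \<open>k\<close>. It makes the weights bounded by \<open>M\<close>, so that they have a cluster point \<open>\<zeta>\<close>; it passes to
  \<open>\<zeta>\<close> and gives convergence of the series; and it bounds the mass outside a cube of radius \<open>r\<close>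
  by \<open>M / r\<^sup>2\<close>, so that the lower bound for the energy, which fails to be preserved by mere
  pointwise limits of weights, passes to \<open>\<zeta>\<close> as well. The upper bound passes to \<open>\<zeta>\<close> on finite
  sets of dual vectors, which is enough because all terms are nonnegative.
\<close>

lemma weights_limit:
  fixes L :: "(real^'n) set" and z :: "nat \<Rightarrow> real^'n \<Rightarrow> real" and \<delta> :: "nat \<Rightarrow> real"
  assumes B: "dual_bases I e d" "L = dual_bases.lat I d" "dual_lattice L = dual_bases.lat I e"
  defines "U \<equiv> dual_bases.cube I e" and "N \<equiv> \<lambda>k. 2 * real k + 1"
  assumes nonneg: "\<And>k u. 0 \<le> z k u" and even: "\<And>k u. z k (- u) = z k u"
    and z0: "\<And>k. z k 0 = 0" and supp: "\<And>k u. u \<notin> U k \<Longrightarrow> z k u = 0"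
    and lower: "\<And>k v. v \<in> L \<Longrightarrow>
      (infdist (v /\<^sub>R N k) L)\<^sup>2 \<le> 2 * (\<Sum>u\<in>U k. z k u * (1 - cos (2 * pi * (u \<bullet> (v /\<^sub>R N k)))))"
    and upper: "\<And>k v. v \<in> L \<Longrightarrow>
      2 * (\<Sum>u\<in>U k. z k u * (1 - cos (2 * pi * (u \<bullet> (v /\<^sub>R N k))))) \<le> (\<delta> k * norm (v /\<^sub>R N k))\<^sup>2"
    and \<delta>: "\<delta> \<longlonglongrightarrow> c"
  shows "\<exists>\<zeta>. feasible L (c\<^sup>2) \<zeta>"
proof -
  interpret dual_bases I e d by (rule B)
  interpret dual: dual_bases I d e by (rule swap)
  interpret closed_subgroup L by (rule closed_subgroup_lat[OF B(1,2)])
  define \<Lambda> where "\<Lambda> = dual_lattice L"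
  have \<Lambda>: "\<Lambda> = dual.lat" unfolding \<Lambda>_def by (rule B)
  have N: "N k > 0" for k by (simp add: N_def)
  have fin: "finite (U k)" for k by (simp add: U_def dual.finite_cube)
  have U: "U k \<subseteq> \<Lambda>" for k using dual.cube_lat by (auto simp: U_def \<Lambda>)
  have coord_le: "\<bar>u \<bullet> e i\<bar> \<le> k" if "u \<in> U k" "i \<in> I" for u k i
    using that by (auto simp: U_def dual.cube_def inner_commute)
  define q where "q u = (\<Sum>i\<in>I. (u \<bullet> e i)\<^sup>2)" for u
  have q0: "0 \<le> q u" for u by (simp add: q_def sum_nonneg)
  have q1: "1 \<le> q u" if u: "u \<in> \<Lambda>" "u \<noteq> 0" for u
  proof -
    obtain i where i: "i \<in> I" "u \<bullet> e i \<noteq> 0"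
      using dual.coord_eqI[of u 0] u(2) by (auto simp: inner_commute)
    have "u \<bullet> e i \<in> \<int>" using u(1) i(1) by (simp add: \<Lambda> dual.lat_def inner_commute)
    then have "1 \<le> \<bar>u \<bullet> e i\<bar>" using i(2) by (rule Ints_nonzero_abs_ge1)
    then have "1 \<le> (u \<bullet> e i)\<^sup>2" using one_le_power[of "\<bar>u \<bullet> e i\<bar>" 2] by simp
    also have "\<dots> \<le> q u" unfolding q_def using i finite_index by (intro member_le_sum) auto
    finally show ?thesis .
  qed
  obtain D where D: "\<And>k. \<bar>\<delta> k\<bar> \<le> D"
    using convergent_imp_Bseq[OF convergentI[OF \<delta>]] by (auto simp: Bseq_def)
  define M where "M = (\<Sum>i\<in>I. D\<^sup>2 * (norm (e i))\<^sup>2)"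
  have M: "0 \<le> M" by (simp add: M_def sum_nonneg)
  have moment: "(\<Sum>u\<in>U k. z k u * q u) \<le> M" for k
  proof -
    have "(\<Sum>u\<in>U k. z k u * (u \<bullet> e i)\<^sup>2) \<le> D\<^sup>2 * (norm (e i))\<^sup>2" if i: "i \<in> I" for i
    proof -
      have "4 * (z k u * (u \<bullet> e i)\<^sup>2) / (N k)\<^sup>2 \<le> 2 * (z k u * (1 - cos (2 * pi * (u \<bullet> (e i /\<^sub>R N k)))))"
        if u: "u \<in> U k" for u
      proof -
        have "\<bar>u \<bullet> (e i /\<^sub>R N k)\<bar> \<le> 1 / 2"
          using coord_le[OF u i] N[of k] by (simp add: N_def field_simps abs_mult)
        from mult_left_mono[OF one_minus_cos_ge[OF this] nonneg[of k u]]
        have "2 * (z k u * (2 * (u \<bullet> (e i /\<^sub>R N k))\<^sup>2)) \<le>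
            2 * (z k u * (1 - cos (2 * pi * (u \<bullet> (e i /\<^sub>R N k)))))" by linarith
        moreover have "2 * (z k u * (2 * (u \<bullet> (e i /\<^sub>R N k))\<^sup>2)) = 4 * (z k u * (u \<bullet> e i)\<^sup>2) / (N k)\<^sup>2"
          using N[of k] by (simp add: power_mult_distrib field_simps)
        ultimately show ?thesis by simp
      qed
      then have "(\<Sum>u\<in>U k. 4 * (z k u * (u \<bullet> e i)\<^sup>2) / (N k)\<^sup>2) \<le>
          (\<Sum>u\<in>U k. 2 * (z k u * (1 - cos (2 * pi * (u \<bullet> (e i /\<^sub>R N k))))))"
        by (rule sum_mono)
      then have "4 * (\<Sum>u\<in>U k. z k u * (u \<bullet> e i)\<^sup>2) / (N k)\<^sup>2 \<le>
          2 * (\<Sum>u\<in>U k. z k u * (1 - cos (2 * pi * (u \<bullet> (e i /\<^sub>R N k)))))"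
        by (simp only: sum_distrib_left sum_divide_distrib)
      also have "\<dots> \<le> (\<delta> k * norm (e i /\<^sub>R N k))\<^sup>2"
        using basis_in_lat[OF i] by (intro upper) (simp add: B(2))
      also have "\<dots> = (\<delta> k)\<^sup>2 * (norm (e i))\<^sup>2 / (N k)\<^sup>2"
        using N[of k] by (simp add: power_mult_distrib power_divide field_simps)
      finally have "4 * (\<Sum>u\<in>U k. z k u * (u \<bullet> e i)\<^sup>2) \<le> (\<delta> k)\<^sup>2 * (norm (e i))\<^sup>2"
        using N[of k] by (simp add: divide_le_cancel)
      moreover have "(\<delta> k)\<^sup>2 \<le> D\<^sup>2"
        using power_mono[OF D[of k] abs_ge_zero, of 2] by simp
      then have "(\<delta> k)\<^sup>2 * (norm (e i))\<^sup>2 \<le> D\<^sup>2 * (norm (e i))\<^sup>2"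
        by (rule mult_right_mono) simp
      moreover have "0 \<le> (\<Sum>u\<in>U k. z k u * (u \<bullet> e i)\<^sup>2)" by (simp add: sum_nonneg nonneg)
      ultimately show ?thesis by linarith
    qed
    then have "(\<Sum>i\<in>I. \<Sum>u\<in>U k. z k u * (u \<bullet> e i)\<^sup>2) \<le> M"
      unfolding M_def by (rule sum_mono)
    then show ?thesis
      unfolding q_def sum_distrib_left by (subst sum.swap)
  qed
  have partial: "(\<Sum>u\<in>S. z k u * g u) \<le> (\<Sum>u\<in>U k. z k u * g u)"
    if S: "finite S" and g: "\<And>u. 0 \<le> g u" for S k and g :: "real^'n \<Rightarrow> real"
  proof -
    have "(\<Sum>u\<in>S. z k u * g u) = (\<Sum>u\<in>S \<inter> U k. z k u * g u)"
      using S supp by (intro sum.mono_neutral_right) auto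
    also have "\<dots> \<le> (\<Sum>u\<in>U k. z k u * g u)"
      using fin g nonneg by (intro sum_mono2) auto
    finally show ?thesis .
  qed
  have bounded: "z k u \<in> {0..M}" for k u
  proof (cases "u \<in> U k \<and> u \<noteq> 0")
    case True
    then have "1 \<le> q u" using q1 U by blast
    then have "z k u \<le> z k u * q u" using mult_left_mono[OF _ nonneg[of k u], of 1 "q u"] by simp
    also have "\<dots> \<le> M" using partial[of "{u}" q k] q0 moment[of k] by simp
    finally show ?thesis using nonneg by simp
  next
    case False
    then show ?thesis using z0 supp M by auto
  qed
  obtain \<zeta> G where G: "G \<noteq> bot" "G \<le> sequentially" "\<And>u. ((\<lambda>k. z k u) \<longlongrightarrow> \<zeta> u) G"
    using bounded_functions_cluster[of z M, OF bounded] by blast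
  have seqG: "(X \<longlongrightarrow> l) G" if "X \<longlonglongrightarrow> l" for X :: "nat \<Rightarrow> 'b::topological_space" and l
    by (rule tendsto_mono[OF G(2) that])
  have \<zeta>_nonneg: "0 \<le> \<zeta> u" for u
    by (rule tendsto_lowerbound[OF G(3) _ G(1)]) (simp add: nonneg)
  have \<zeta>_even: "\<zeta> (- u) = \<zeta> u" for u
    by (rule tendsto_unique[OF G(1) _ G(3)]) (use G(3)[of "- u"] in \<open>simp add: even\<close>)
  have \<zeta>_0: "\<zeta> 0 = 0"
    by (rule tendsto_unique[OF G(1) G(3)]) (simp add: z0)
  have \<zeta>_moment: "(\<Sum>u\<in>S. \<zeta> u * q u) \<le> M" if S: "finite S" for S
  proof (rule tendsto_upperbound[OF _ _ G(1)])
    show "((\<lambda>k. \<Sum>u\<in>S. z k u * q u) \<longlongrightarrow> (\<Sum>u\<in>S. \<zeta> u * q u)) G"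
      by (intro tendsto_intros G(3))
    show "eventually (\<lambda>k. (\<Sum>u\<in>S. z k u * q u) \<le> M) G"
      using partial[of S q] S q0 moment by (intro always_eventually allI) (meson order_trans)
  qed
  have sum_q: "(\<lambda>u. \<zeta> u * q u) summable_on \<Lambda>"
    using \<zeta>_moment by (intro nonneg_bdd_above_summable_on) (auto intro!: bdd_aboveI[of _ M] simp: \<zeta>_nonneg q0)
  have sum_\<zeta>: "\<zeta> summable_on \<Lambda>"
  proof (rule summable_on_comparison_test[OF sum_q])
    fix u assume "u \<in> \<Lambda>"
    then show "\<zeta> u \<le> \<zeta> u * q u"
      using mult_left_mono[OF q1[of u] \<zeta>_nonneg[of u]] \<zeta>_0 by (cases "u = 0") auto
  qed (rule \<zeta>_nonneg)
  have sum_outer: "(\<lambda>u. \<zeta> u *\<^sub>R outer_square u) summable_on \<Lambda>"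
  proof (rule abs_summable_summable, rule summable_on_comparison_test)
    show "(\<lambda>u. (\<Sum>i\<in>I. (norm (d i))\<^sup>2) * (\<zeta> u * q u)) summable_on \<Lambda>"
      by (intro summable_on_cmult_right sum_q)
    fix u assume "u \<in> \<Lambda>"
    have "\<zeta> u * (norm u)\<^sup>2 \<le> \<zeta> u * ((\<Sum>i\<in>I. (norm (d i))\<^sup>2) * q u)"
      using dual.norm_le_coords[of u] by (intro mult_left_mono \<zeta>_nonneg) (simp add: q_def inner_commute)
    then show "norm (\<zeta> u *\<^sub>R outer_square u) \<le> (\<Sum>i\<in>I. (norm (d i))\<^sup>2) * (\<zeta> u * q u)"
      by (simp add: norm_outer_square \<zeta>_nonneg mult_ac)
  qed simp
  \<comment> \<open>The bounds hold at points of \<open>(1/N) L\<close> only, so an arbitrary \<open>x\<close> is approximated by such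
    points \<open>a x k\<close>, which move together with the weights.\<close>
  define v where "v x k = (\<Sum>i\<in>I. of_int (round (N k * (d i \<bullet> x))) *\<^sub>R e i)" for x k
  define a where "a x k = v x k /\<^sub>R N k" for x k
  have v: "v x k \<in> L" for x k unfolding B(2) lat_def v_def by (simp add: coord_comb)
  have a: "(\<lambda>k. a x k) \<longlonglongrightarrow> x" for x
  proof -
    have "(\<lambda>k. of_int (round (N k * t)) / N k) \<longlonglongrightarrow> t" for t
    proof (rule LIM_zero_cancel, rule Lim_null_comparison[where g = "\<lambda>k. (1 / 2) / N k"])
      show "eventually (\<lambda>k. norm (of_int (round (N k * t)) / N k - t) \<le> (1 / 2) / N k) sequentially"
      proof (intro always_eventually allI)
        fix k
        have "of_int (round (N k * t)) / N k - t = (of_int (round (N k * t)) - N k * t) / N k"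
          using N[of k] by (simp add: field_simps)
        then show "norm (of_int (round (N k * t)) / N k - t) \<le> (1 / 2) / N k"
          using divide_right_mono[OF of_int_round_abs_le[of "N k * t"], of "N k"] N[of k] by simp
      qed
      show "(\<lambda>k. (1 / 2) / N k) \<longlonglongrightarrow> 0"
        unfolding N_def by real_asymp
    qed
    then have "(\<lambda>k. \<Sum>i\<in>I. (of_int (round (N k * (d i \<bullet> x))) / N k) *\<^sub>R e i) \<longlonglongrightarrow> (\<Sum>i\<in>I. (d i \<bullet> x) *\<^sub>R e i)"
      by (intro tendsto_intros)
    then show ?thesis
      by (simp add: a_def v_def scaleR_sum_right divide_inverse mult.commute expand[of x, symmetric])
  qed
  have \<zeta>_upper: "2 * (\<Sum>u\<in>S. \<zeta> u * (1 - cos (2 * pi * (u \<bullet> x)))) \<le> (c * norm x)\<^sup>2"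
    if S: "finite S" for S x
  proof (rule tendsto_le[OF G(1)])
    show "((\<lambda>k. (\<delta> k * norm (a x k))\<^sup>2) \<longlongrightarrow> (c * norm x)\<^sup>2) G"
      by (intro seqG tendsto_intros \<delta> a)
    show "((\<lambda>k. 2 * (\<Sum>u\<in>S. z k u * (1 - cos (2 * pi * (u \<bullet> a x k))))) \<longlongrightarrow>
        2 * (\<Sum>u\<in>S. \<zeta> u * (1 - cos (2 * pi * (u \<bullet> x))))) G"
      by (intro tendsto_intros G(3) seqG[OF a])
    show "eventually (\<lambda>k. 2 * (\<Sum>u\<in>S. z k u * (1 - cos (2 * pi * (u \<bullet> a x k)))) \<le>
        (\<delta> k * norm (a x k))\<^sup>2) G"
    proof (intro always_eventually allI)
      fix k
      have "(\<Sum>u\<in>S. z k u * (1 - cos (2 * pi * (u \<bullet> a x k)))) \<le>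
          (\<Sum>u\<in>U k. z k u * (1 - cos (2 * pi * (u \<bullet> a x k))))"
        by (rule partial[OF S]) simp
      then show "2 * (\<Sum>u\<in>S. z k u * (1 - cos (2 * pi * (u \<bullet> a x k)))) \<le> (\<delta> k * norm (a x k))\<^sup>2"
        using upper[OF v[of x k], of k] unfolding a_def by linarith
    qed
  qed
  have "4 * pi\<^sup>2 * (\<Sum>u\<in>S. \<zeta> u * (u \<bullet> x)\<^sup>2) \<le> c\<^sup>2 * (norm x)\<^sup>2" if S: "finite S" for S x
  proof (rule tendsto_upperbound)
    have "((\<lambda>h. \<Sum>u\<in>S. \<zeta> u * (2 * (1 - cos (2 * pi * (u \<bullet> x * h))) / h\<^sup>2)) \<longlongrightarrow>
        (\<Sum>u\<in>S. \<zeta> u * (4 * pi\<^sup>2 * (u \<bullet> x)\<^sup>2))) (at 0)"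
      by (intro tendsto_intros second_difference_cos)
    then show "((\<lambda>h. \<Sum>u\<in>S. \<zeta> u * (2 * (1 - cos (2 * pi * (u \<bullet> x * h))) / h\<^sup>2)) \<longlongrightarrow>
        4 * pi\<^sup>2 * (\<Sum>u\<in>S. \<zeta> u * (u \<bullet> x)\<^sup>2)) (at 0)"
      by (simp add: sum_distrib_left mult_ac)
    show "eventually (\<lambda>h. (\<Sum>u\<in>S. \<zeta> u * (2 * (1 - cos (2 * pi * (u \<bullet> x * h))) / h\<^sup>2)) \<le> c\<^sup>2 * (norm x)\<^sup>2) (at 0)"
    proof (rule eventually_mono[OF eventually_neq_at_within[of 0]])
      fix h :: real assume h: "h \<noteq> 0"
      have "2 * (\<Sum>u\<in>S. \<zeta> u * (1 - cos (2 * pi * (u \<bullet> x * h)))) \<le> c\<^sup>2 * (norm x)\<^sup>2 * h\<^sup>2"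
        using \<zeta>_upper[OF S, of "h *\<^sub>R x"] by (simp add: power_mult_distrib mult_ac)
      then have "2 * (\<Sum>u\<in>S. \<zeta> u * (1 - cos (2 * pi * (u \<bullet> x * h)))) / h\<^sup>2 \<le> c\<^sup>2 * (norm x)\<^sup>2"
        using h by (simp add: divide_le_eq)
      then show "(\<Sum>u\<in>S. \<zeta> u * (2 * (1 - cos (2 * pi * (u \<bullet> x * h))) / h\<^sup>2)) \<le> c\<^sup>2 * (norm x)\<^sup>2"
        by (simp add: sum_distrib_left sum_divide_distrib mult_ac)
    qed
  qed simp
  then have "(\<Sum>u\<in>S. 4 * pi\<^sup>2 * (\<zeta> u * (u \<bullet> x)\<^sup>2)) \<le> c\<^sup>2 * (norm x)\<^sup>2" if "finite S" for S x
    using that by (simp add: sum_distrib_left)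
  then have "(\<Sum>\<^sub>\<infinity>u\<in>\<Lambda>. 4 * pi\<^sup>2 * (\<zeta> u * (u \<bullet> x)\<^sup>2)) \<le> c\<^sup>2 * (norm x)\<^sup>2" for x
    by (intro infsum_le_finite_sums summable_on_cmult_right psd_outer_series(1) sum_outer)
  then have spectral: "4 * pi\<^sup>2 * (\<Sum>\<^sub>\<infinity>u\<in>\<Lambda>. \<zeta> u * (u \<bullet> x)\<^sup>2) \<le> c\<^sup>2 * (norm x)\<^sup>2" for x
    by (simp only: infsum_cmult_right')
  \<comment> \<open>The summation range is cut at the cube of radius \<open>r\<close> before the limit in \<open>k\<close> is taken, and
    the cut is removed afterwards by letting \<open>r\<close> tend to infinity.\<close>
  have \<zeta>_lower: "(infdist x L)\<^sup>2 \<le> char_energy \<Lambda> \<zeta> x + 4 * M / (real r)\<^sup>2" if r: "r > 0" for x r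
  proof -
    have "(infdist x L)\<^sup>2 \<le> 2 * (\<Sum>u\<in>U r. \<zeta> u * (1 - cos (2 * pi * (u \<bullet> x)))) + 4 * M / (real r)\<^sup>2"
    proof (rule tendsto_le[OF G(1)])
      show "((\<lambda>k. 2 * (\<Sum>u\<in>U r. z k u * (1 - cos (2 * pi * (u \<bullet> a x k)))) + 4 * M / (real r)\<^sup>2) \<longlongrightarrow>
          2 * (\<Sum>u\<in>U r. \<zeta> u * (1 - cos (2 * pi * (u \<bullet> x)))) + 4 * M / (real r)\<^sup>2) G"
        by (intro tendsto_intros G(3) seqG[OF a])
      show "((\<lambda>k. (infdist (a x k) L)\<^sup>2) \<longlongrightarrow> (infdist x L)\<^sup>2) G"
        by (intro tendsto_intros tendsto_infdist seqG[OF a])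
      show "eventually (\<lambda>k. (infdist (a x k) L)\<^sup>2 \<le>
          2 * (\<Sum>u\<in>U r. z k u * (1 - cos (2 * pi * (u \<bullet> a x k)))) + 4 * M / (real r)\<^sup>2) G"
      proof (intro always_eventually allI)
        fix k
        let ?f = "\<lambda>u. z k u * (1 - cos (2 * pi * (u \<bullet> a x k)))"
        have tail: "?f u \<le> 2 * (z k u * q u) / (real r)\<^sup>2" if u: "u \<in> U k - U r" for u
        proof -
          obtain i where i: "i \<in> I" "real r < \<bar>u \<bullet> e i\<bar>"
            using u U[of k] by (auto simp: U_def \<Lambda> dual.cube_def inner_commute not_le)
          then have "(real r)\<^sup>2 \<le> (u \<bullet> e i)\<^sup>2"
            using power_mono[of "real r" "\<bar>u \<bullet> e i\<bar>" 2] by simp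
          also have "\<dots> \<le> q u" unfolding q_def using i finite_index by (intro member_le_sum) auto
          finally have "1 \<le> q u / (real r)\<^sup>2" using r by simp
          moreover have "1 - cos (2 * pi * (u \<bullet> a x k)) \<le> 2"
            using cos_ge_minus_one[of "2 * pi * (u \<bullet> a x k)"] by linarith
          ultimately have "1 - cos (2 * pi * (u \<bullet> a x k)) \<le> 2 * (q u / (real r)\<^sup>2)" by linarith
          from mult_left_mono[OF this nonneg[of k u]] show ?thesis by (simp add: mult_ac)
        qed
        have "(\<Sum>u\<in>U k. ?f u) = (\<Sum>u\<in>U k \<inter> U r. ?f u) + (\<Sum>u\<in>U k - U r. ?f u)"
          by (rule sum.Int_Diff[OF fin])
        also have "(\<Sum>u\<in>U k \<inter> U r. ?f u) \<le> (\<Sum>u\<in>U r. ?f u)"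
          using fin nonneg by (intro sum_mono2) auto
        also have "(\<Sum>u\<in>U k - U r. ?f u) \<le> (\<Sum>u\<in>U k - U r. 2 * (z k u * q u) / (real r)\<^sup>2)"
          by (intro sum_mono tail)
        also have "\<dots> \<le> (\<Sum>u\<in>U k. 2 * (z k u * q u) / (real r)\<^sup>2)"
          using fin nonneg q0 by (intro sum_mono2) auto
        also have "\<dots> = 2 * (\<Sum>u\<in>U k. z k u * q u) / (real r)\<^sup>2"
          by (simp only: sum_distrib_left sum_divide_distrib)
        also have "\<dots> \<le> 2 * M / (real r)\<^sup>2"
          by (intro divide_right_mono mult_left_mono moment) simp_all
        finally show "(infdist (a x k) L)\<^sup>2 \<le> 2 * (\<Sum>u\<in>U r. ?f u) + 4 * M / (real r)\<^sup>2"
          using lower[OF v[of x k], of k] unfolding a_def by simp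
      qed
    qed
    also have "(\<Sum>u\<in>U r. \<zeta> u * (1 - cos (2 * pi * (u \<bullet> x)))) \<le>
        (\<Sum>\<^sub>\<infinity>u\<in>\<Lambda>. \<zeta> u * (1 - cos (2 * pi * (u \<bullet> x))))"
      using fin U \<zeta>_nonneg by (intro finite_sum_le_infsum summable_char_energy sum_\<zeta>) auto
    finally show ?thesis by (simp add: char_energy_def)
  qed
  have energy: "(infdist x L)\<^sup>2 \<le> char_energy \<Lambda> \<zeta> x" for x
  proof (rule LIMSEQ_le_const)
    have "(\<lambda>r. 4 * M / (real r)\<^sup>2) \<longlonglongrightarrow> 0" by real_asymp
    then show "(\<lambda>r. char_energy \<Lambda> \<zeta> x + 4 * M / (real r)\<^sup>2) \<longlonglongrightarrow> char_energy \<Lambda> \<zeta> x"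
      using tendsto_add[OF tendsto_const] by fastforce
    show "\<exists>R. \<forall>r\<ge>R. (infdist x L)\<^sup>2 \<le> char_energy \<Lambda> \<zeta> x + 4 * M / (real r)\<^sup>2"
      using \<zeta>_lower by (intro exI[of _ 1]) auto
  qed
  have "(norm x)\<^sup>2 \<le> char_energy \<Lambda> \<zeta> x" if "x \<in> voronoi_cell L" for x
    using energy[of x] infdist_voronoi[OF that] by simp
  then have "feasible L (c\<^sup>2) (\<lambda>u. of_real (\<zeta> u))"
    unfolding feasible_iff \<Lambda>_def[symmetric]
    using sum_\<zeta> sum_outer spectral
    by (auto simp: ell1_def \<zeta>_nonneg \<zeta>_even less_eq_complex_def)
  then show ?thesis by blast
qed

section \<open>The least distortion\<close>

theorem theorem2p3:
  fixes L :: "(real^'n) set"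
  assumes "is_lattice L"
  shows "\<exists>C. (\<exists>z. feasible L C z) \<and> (\<forall>C' z'. feasible L C' z' \<longrightarrow> C \<le> C') \<and>
             (c2 L)\<^sup>2 = ennreal C"
proof -
  obtain B d where B: "dual_bases B (\<lambda>b. b) d" "L = dual_bases.lat B d"
    "dual_lattice L = dual_bases.lat B (\<lambda>b. b)"
    using lattice_dual_bases[OF assms] by metis
  have L: "L \<noteq> UNIV" using dual_bases.lat_neq_UNIV[OF B(1)] B(2) by simp
  have "(c2 L)\<^sup>2 \<noteq> \<infinity>"
    using feasible_exists[OF assms] feasible_imp_c2_le[OF assms]
    by (metis ennreal_less_top infinity_ennreal_def leD)
  then have "c2 L \<noteq> \<infinity>" by (auto simp: power2_eq_square)
  then obtain c where c: "c2 L = ennreal c" "0 \<le> c" by (cases "c2 L") auto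
  have "\<exists>z D. c \<le> D \<and> D \<le> c + 1 / (real k + 1) \<and>
      (\<forall>u. 0 \<le> z u) \<and> (\<forall>u. z (- u) = z u) \<and> z 0 = 0 \<and>
      (\<forall>u. u \<notin> dual_bases.cube B (\<lambda>b. b) k \<longrightarrow> z u = 0) \<and>
      (\<forall>v\<in>L. (infdist (v /\<^sub>R (2 * real k + 1)) L)\<^sup>2 \<le> 2 * (\<Sum>u\<in>dual_bases.cube B (\<lambda>b. b) k.
          z u * (1 - cos (2 * pi * (u \<bullet> (v /\<^sub>R (2 * real k + 1))))))) \<and>
      (\<forall>v\<in>L. 2 * (\<Sum>u\<in>dual_bases.cube B (\<lambda>b. b) k.
          z u * (1 - cos (2 * pi * (u \<bullet> (v /\<^sub>R (2 * real k + 1)))))) \<le> (D * norm (v /\<^sub>R (2 * real k + 1)))\<^sup>2)"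
    (is "\<exists>z D. ?P k z D") for k
  proof -
    have "c2 L < ennreal (c + 1 / (real k + 1))"
      unfolding c(1) using c(2) by (subst ennreal_less_iff) auto
    then obtain H :: "((real^'n) set \<Rightarrow> complex) inner_space" and \<phi>
      where emb: "euclidean_embedding L H \<phi>" and less: "distortion L H \<phi> < ennreal (c + 1 / (real k + 1))"
      unfolding c2_def Inf_less_iff by blast
    then obtain D where D: "distortion L H \<phi> = ennreal D" "0 \<le> D"
      by (cases "distortion L H \<phi>") auto
    have "c \<le> D" using c2_le_distortion[OF emb] D c by simp
    moreover have "D \<le> c + 1 / (real k + 1)"
      using less D c by (auto simp: ennreal_less_iff simp del: ennreal_plus)
    ultimately have bounds: "c \<le> D \<and> D \<le> c + 1 / (real k + 1)" ..
    show ?thesis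
    proof (rule embedding_weights[OF B(1,2) L emb D, of k], goal_cases)
      case (1 z)
      show ?thesis
        by (intro exI[of _ z] exI[of _ D] conjI allI impI ballI) (use 1 bounds in simp_all)
    qed
  qed
  then obtain z where "\<forall>k. \<exists>D. ?P k (z k) D" using choice[of "\<lambda>k z. \<exists>D. ?P k z D"] by blast
  then obtain \<delta> where P: "\<And>k. ?P k (z k) (\<delta> k)" using choice[of "\<lambda>k D. ?P k (z k) D"] by blast
  have "\<delta> \<longlonglongrightarrow> c"
  proof (rule tendsto_sandwich)
    show "eventually (\<lambda>k. c \<le> \<delta> k) sequentially"
      "eventually (\<lambda>k. \<delta> k \<le> c + 1 / (real k + 1)) sequentially"
      using P by (blast intro: always_eventually)+
    show "(\<lambda>k. c + 1 / (real k + 1)) \<longlonglongrightarrow> c" by real_asymp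
  qed simp
  then obtain \<zeta> where \<zeta>: "feasible L (c\<^sup>2) \<zeta>"
    using weights_limit[OF B, of z \<delta> c] P by blast
  have sq: "(c2 L)\<^sup>2 = ennreal (c\<^sup>2)" using c by (simp add: ennreal_power)
  have "c\<^sup>2 \<le> C'" if "feasible L C' z'" for C' z'
    using feasible_imp_c2_le[OF assms that] that unfolding sq
    by (simp add: feasible_def)
  then show ?thesis using \<zeta> sq by blast
qed

end
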